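(* Let $A$ and $C$ be two positive constants, let $k>0$ be real, and let $g:\mathbb{C}\to\mathbb{C}$ be such that: (i) $g$ is analytic everywhere except on the two cuts $\gamma(\pm k)=\{\pm k-iy : y\ge 0\}$; (ii) $|g(z)|\le Ce^{A|z|}$ for any $z\in\Pi_+=\{z\in\mathbb{C}:\operatorname{Im}z>0\}$; (iii) $\int_{\mathbb{R}}|g(x)|^2\,dx<+\infty$. Define the function $G$ on $\mathbb{R}$ by $G=\mathcal{F}g$, where $\mathcal{F}$ is the $L^2$-Fourier transform (applied to the restriction of $g$ to $\mathbb{R}$). Then the support of $G$ is a subset of $[-A,+\infty)$ and $G\in L^2(-A,+\infty)$.
   Context: The Fourier transform has the sign convention $\mathcal{F}g(t)=\int_{\mathbb{R}}g(x)e^{-itx}\,dx$ (extended to $L^2(\mathbb{R})$ by Plancherel; the normalization constant is irrelevant). *)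

theory Defs
  imports "HOL-Analysis.Analysis"
begin

definition lower_cut :: "complex \<Rightarrow> complex set" where
  "lower_cut a = {a - \<i> * of_real y | y. y \<ge> (0::real)}"

definition L2_on :: "real set \<Rightarrow> (real \<Rightarrow> complex) \<Rightarrow> bool" where
  "L2_on S f \<longleftrightarrow> set_borel_measurable lborel S f
     \<and> set_integrable lborel S (\<lambda>x. (cmod (f x))\<^sup>2)"

definition L2_tendsto :: "(nat \<Rightarrow> real \<Rightarrow> complex) \<Rightarrow> (real \<Rightarrow> complex) \<Rightarrow> bool" where
  "L2_tendsto f h \<longleftrightarrow>
     (\<lambda>n. \<integral>\<^sup>+ x. ennreal ((cmod (f n x - h x))\<^sup>2) \<partial>lborel) \<longlonglongrightarrow> 0"

definition fourier_L1 :: "(real \<Rightarrow> complex) \<Rightarrow> real \<Rightarrow> complex" where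
  "fourier_L1 f t = (LINT x|lborel. f x * exp (- (\<i> * of_real t * of_real x)))"

(* G represents the image of g under the continuous extension of fourier_L1
   from L1 Int L2 to L2.  By Plancherel, for g in L2 such a G exists, and any two
   agree almost everywhere, whatever approximating sequence is used. *)
definition has_fourier_L2 :: "(real \<Rightarrow> complex) \<Rightarrow> (real \<Rightarrow> complex) \<Rightarrow> bool" where
  "has_fourier_L2 g G \<longleftrightarrow> L2_on UNIV G \<and>
     (\<exists>f. (\<forall>n. integrable lborel (f n) \<and> L2_on UNIV (f n))
        \<and> L2_tendsto f g \<and> L2_tendsto (\<lambda>n. fourier_L1 (f n)) G)"

(* Elements of L2 are classes modulo null sets; this picks a representative. *)
definition fourier_L2 :: "(real \<Rightarrow> complex) \<Rightarrow> real \<Rightarrow> complex" where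
  "fourier_L2 g = (SOME G. has_fourier_L2 g G)"

(* The support of a class of functions modulo null sets: the complement of the
   largest open set on which the function vanishes almost everywhere.  The closure
   of the nonzero set of a single representative would not be invariant. *)
definition ess_support :: "(real \<Rightarrow> complex) \<Rightarrow> real set" where
  "ess_support G =
     - \<Union>{U. open U \<and> (AE t in lborel. t \<in> U \<longrightarrow> G t = 0)}"

end

theory Submission
  imports Defs "HOL-Probability.Probability" "HOL-Complex_Analysis.Complex_Analysis"
begin

text \<open>
  Damp \<open>g\<close> on the real line by \<open>exp (- d \<bar>x\<bar>)\<close> and split the Fourier integral at 0. For frequency
  \<open>t\<close>, put \<open>\<tau> = - t + i d\<close> on the positive half-line and \<open>\<tau> = - t - i d\<close> on the negative one. When
  \<open>Re \<tau>\<close> and \<open>\<bar>Im \<tau>\<bar>\<close> exceed \<open>2 A\<close>, the contour of each half-line integral can be rotated to the positive imaginary axis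
  by Cauchy's theorem, and both become, up to sign, the same function
  \<open>J \<tau> = i \<integral> g (i y) exp (- \<tau> y) dy\<close>, which is holomorphic for \<open>Re \<tau> > A\<close>; by
  analytic continuation this persists for all \<open>\<tau>\<close> with \<open>Re \<tau> > A\<close> in the respective half-plane. Hence for
  \<open>t < - A\<close> the damped transform is \<open>J (- t + i d) - J (- t - i d)\<close>, which tends to 0 with \<open>d\<close>.
  Since the damped functions tend to \<open>g\<close> in \<open>L\<^sup>2\<close>, their transforms tend to \<open>G\<close> in \<open>L\<^sup>2\<close> by
  Plancherel's inequality, and Fatou's lemma gives \<open>G = 0\<close> almost everywhere below \<open>- A\<close>.
\<close>

section \<open>Square-integrable functions on the line\<close>

text \<open>The squared norm takes values in \<open>ennreal\<close>, so that comparison, limits and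
  Fatou's lemma can be used before finiteness is known.\<close>

definition L2sq :: "(real \<Rightarrow> complex) \<Rightarrow> ennreal" where
  "L2sq f = (\<integral>\<^sup>+x. ennreal ((cmod (f x))\<^sup>2) \<partial>lborel)"

lemma L2_tendsto_iff: "L2_tendsto f h \<longleftrightarrow> (\<lambda>n. L2sq (\<lambda>x. f n x - h x)) \<longlonglongrightarrow> 0"
  by (simp add: L2_tendsto_def L2sq_def)

lemma L2_on_UNIV_iff: "L2_on UNIV f \<longleftrightarrow> f \<in> borel_measurable borel \<and> L2sq f < \<infinity>"
  unfolding L2_on_def L2sq_def set_borel_measurable_def set_integrable_def
  by (auto simp: integrable_iff_bounded)

text \<open>A substitute for Minkowski's inequality: it follows pointwise from
  \<open>(a - b)^2 >= 0\<close>, and the lost factor 2 is harmless in convergence arguments.\<close>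

lemma L2sq_add_le:
  assumes [measurable]: "f \<in> borel_measurable borel" "h \<in> borel_measurable borel"
  shows "L2sq (\<lambda>x. f x + h x) \<le> 2 * L2sq f + 2 * L2sq h"
proof -
  have pt: "(cmod (a + b))\<^sup>2 \<le> 2 * (cmod a)\<^sup>2 + 2 * (cmod b)\<^sup>2" for a b
  proof -
    have "(cmod (a + b))\<^sup>2 \<le> (cmod a + cmod b)\<^sup>2"
      by (intro power_mono norm_triangle_ineq) auto
    also have "\<dots> \<le> 2 * (cmod a)\<^sup>2 + 2 * (cmod b)\<^sup>2"
      using zero_le_power2[of "cmod a - cmod b"] by (simp add: power2_sum power2_diff)
    finally show ?thesis .
  qed
  have "L2sq (\<lambda>x. f x + h x) \<le> (\<integral>\<^sup>+x. 2 * ennreal ((cmod (f x))\<^sup>2) + 2 * ennreal ((cmod (h x))\<^sup>2) \<partial>lborel)"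
    unfolding L2sq_def
  proof (intro nn_integral_mono)
    fix x
    have "ennreal ((cmod (f x + h x))\<^sup>2) \<le> ennreal (2 * (cmod (f x))\<^sup>2 + 2 * (cmod (h x))\<^sup>2)"
      using pt by (intro ennreal_leI)
    then show "ennreal ((cmod (f x + h x))\<^sup>2) \<le> 2 * ennreal ((cmod (f x))\<^sup>2) + 2 * ennreal ((cmod (h x))\<^sup>2)"
      by (simp add: ennreal_mult)
  qed
  also have "\<dots> = 2 * L2sq f + 2 * L2sq h"
    by (simp add: L2sq_def nn_integral_add nn_integral_cmult)
  finally show ?thesis .
qed

lemma L2sq_minus_commute: "L2sq (\<lambda>x. f x - h x) = L2sq (\<lambda>x. h x - f x)"
  by (simp add: L2sq_def norm_minus_commute)

lemma L2sq_triangle: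
  assumes [measurable]: "f \<in> borel_measurable borel" "g \<in> borel_measurable borel" "h \<in> borel_measurable borel"
  shows "L2sq (\<lambda>x. f x - h x) \<le> 2 * L2sq (\<lambda>x. f x - g x) + 2 * L2sq (\<lambda>x. g x - h x)"
  using L2sq_add_le[of "\<lambda>x. f x - g x" "\<lambda>x. g x - h x"] by simp

lemma L2_tendsto_shift:
  assumes [measurable]: "\<And>n. f n \<in> borel_measurable borel" "\<And>n. f' n \<in> borel_measurable borel"
      "g \<in> borel_measurable borel"
    and f: "L2_tendsto f g" and d: "(\<lambda>n. L2sq (\<lambda>x. f' n x - f n x)) \<longlonglongrightarrow> 0"
  shows "L2_tendsto f' g"
  unfolding L2_tendsto_iff
proof (rule tendsto_sandwich[OF _ _ tendsto_const])
  show "\<forall>\<^sub>F n in sequentially. L2sq (\<lambda>x. f' n x - g x)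
      \<le> 2 * L2sq (\<lambda>x. f' n x - f n x) + 2 * L2sq (\<lambda>x. f n x - g x)"
    by (intro always_eventually allI L2sq_triangle) auto
  have "(\<lambda>n. 2 * L2sq (\<lambda>x. f' n x - f n x) + 2 * L2sq (\<lambda>x. f n x - g x)) \<longlonglongrightarrow> 2 * 0 + 2 * 0"
    using f d unfolding L2_tendsto_iff by (intro tendsto_add ennreal_tendsto_cmult) auto
  then show "(\<lambda>n. 2 * L2sq (\<lambda>x. f' n x - f n x) + 2 * L2sq (\<lambda>x. f n x - g x)) \<longlonglongrightarrow> 0"
    by simp
qed simp

text \<open>Mean-square convergence gives pointwise convergence only along subsequences. Fatou's
  lemma avoids choosing one: on \<open>S\<close> the limit of \<open>|f n - G|^2\<close> is
  \<open>|G|^2\<close>, so its integral over \<open>S\<close> is at most the limit 0.\<close>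

lemma L2_tendsto_AE_zero:
  assumes [measurable]: "\<And>n. f n \<in> borel_measurable borel" "G \<in> borel_measurable borel" "S \<in> sets borel"
    and f: "L2_tendsto f G" and z: "\<And>x. x \<in> S \<Longrightarrow> (\<lambda>n. f n x) \<longlonglongrightarrow> 0"
  shows "AE x in lborel. x \<in> S \<longrightarrow> G x = 0"
proof -
  have "(\<integral>\<^sup>+x. ennreal ((cmod (G x))\<^sup>2) * indicator S x \<partial>lborel)
      \<le> (\<integral>\<^sup>+x. liminf (\<lambda>n. ennreal ((cmod (f n x - G x))\<^sup>2)) \<partial>lborel)"
  proof (intro nn_integral_mono)
    fix x
    show "ennreal ((cmod (G x))\<^sup>2) * indicator S x \<le> liminf (\<lambda>n. ennreal ((cmod (f n x - G x))\<^sup>2))"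
    proof (cases "x \<in> S")
      case True
      have "(\<lambda>n. ennreal ((cmod (f n x - G x))\<^sup>2)) \<longlonglongrightarrow> ennreal ((cmod (0 - G x))\<^sup>2)"
        by (intro tendsto_intros z True)
      from lim_imp_Liminf[OF sequentially_bot this] show ?thesis
        using True by simp
    qed simp
  qed
  also have "\<dots> \<le> liminf (\<lambda>n. L2sq (\<lambda>x. f n x - G x))"
    unfolding L2sq_def by (intro nn_integral_liminf) simp
  also have "\<dots> = 0"
    using f unfolding L2_tendsto_iff by (rule lim_imp_Liminf[OF sequentially_bot])
  finally have "(\<integral>\<^sup>+x. ennreal ((cmod (G x))\<^sup>2) * indicator S x \<partial>lborel) = 0" by simp
  then have "AE x in lborel. ennreal ((cmod (G x))\<^sup>2) * indicator S x = 0"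
    by (subst (asm) nn_integral_0_iff_AE) auto
  then show ?thesis
    by eventually_elim (auto simp: indicator_def split: if_splits)
qed

section \<open>Completeness of the space of square-integrable functions\<close>

lemma ennreal_term_le_suminf: "f i \<le> (\<Sum>i. f i)" for f :: "nat \<Rightarrow> ennreal"
  using sum_le_suminf[of f "{i}"] by simp

text \<open>The Riesz-Fischer argument: a rapidly converging subsequence has an almost everywhere
  pointwise limit, and Fatou's lemma transfers the Cauchy estimate to it.\<close>

lemma L2_complete:
  assumes [measurable]: "\<And>n. F n \<in> borel_measurable borel"
    and cauchy: "\<And>e. e > 0 \<Longrightarrow> \<exists>N. \<forall>m\<ge>N. \<forall>n\<ge>N. L2sq (\<lambda>x. F m x - F n x) < ennreal e"
  obtains G where "G \<in> borel_measurable borel" "L2_tendsto F G"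
proof -
  have "\<exists>N. \<forall>i::nat. (\<forall>m\<ge>N i. \<forall>n\<ge>N i. L2sq (\<lambda>x. F m x - F n x) < ennreal ((1/4)^i))"
    by (intro choice allI cauchy) simp
  then obtain N :: "nat \<Rightarrow> nat" where
    N: "\<And>i m n. m \<ge> N i \<Longrightarrow> n \<ge> N i \<Longrightarrow> L2sq (\<lambda>x. F m x - F n x) < ennreal ((1/4)^i)"
    by metis
  \<comment> \<open>Summing all earlier thresholds makes \<open>r\<close> increasing while it still
    dominates \<open>N i\<close> and \<open>i\<close>.\<close>
  define r where "r i = i + (\<Sum>j\<le>i. N j)" for i
  have r_ge: "r i \<ge> N i" "r i \<ge> i" for i
    using member_le_sum[of i "{..i}" N] by (auto simp: r_def)
  have r_mono: "r i \<le> r (Suc i)" for i by (simp add: r_def)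
  define d where "d i x = F (r (Suc i)) x - F (r i) x" for i x
  have [measurable]: "d i \<in> borel_measurable borel" for i by (simp add: d_def[abs_def])
  have d_small: "L2sq (d i) \<le> ennreal ((1/4)^i)" for i
    using N[of i "r (Suc i)" "r i"] r_ge[of i] r_mono[of i] unfolding d_def[abs_def] by simp
  \<comment> \<open>The weight \<open>2^i\<close> costs half of the decay \<open>(1/4)^i\<close>.
    Finiteness of the weighted sum at \<open>x\<close> then forces \<open>d i x\<close> to decay
    geometrically with ratio \<open>sqrt (1/2)\<close>.\<close>
  let ?S = "\<lambda>x. \<Sum>i. ennreal (2^i * (cmod (d i x))\<^sup>2)"
  have "(\<integral>\<^sup>+x. ?S x \<partial>lborel) = (\<Sum>i. \<integral>\<^sup>+x. ennreal (2^i * (cmod (d i x))\<^sup>2) \<partial>lborel)"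
    by (intro nn_integral_suminf) simp
  also have "\<dots> \<le> (\<Sum>i. ennreal ((1/2)^i))"
  proof (intro suminf_le allI)
    fix i
    have "(\<integral>\<^sup>+x. ennreal (2^i * (cmod (d i x))\<^sup>2) \<partial>lborel) = ennreal (2^i) * L2sq (d i)"
      unfolding L2sq_def by (subst nn_integral_cmult[symmetric]) (auto simp: ennreal_mult)
    also have "\<dots> \<le> ennreal (2^i) * ennreal ((1/4)^i)"
      by (intro mult_left_mono d_small) simp
    also have "\<dots> = ennreal ((1/2)^i)"
      by (simp add: ennreal_mult[symmetric] power_mult_distrib[symmetric])
    finally show "(\<integral>\<^sup>+x. ennreal (2^i * (cmod (d i x))\<^sup>2) \<partial>lborel) \<le> ennreal ((1/2)^i)" .
  qed auto
  also have "\<dots> = ennreal (\<Sum>i. (1/2)^i)"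
    by (intro suminf_ennreal2) (auto intro: summable_geometric)
  finally have "(\<integral>\<^sup>+x. ?S x \<partial>lborel) < \<infinity>"
    by (simp add: le_less_trans)
  then have "AE x in lborel. ?S x \<noteq> \<infinity>"
    by (intro nn_integral_noteq_infinite) auto
  then have conv: "AE x in lborel. convergent (\<lambda>i. F (r i) x)"
  proof eventually_elim
    case (elim x)
    define M where "M = enn2real (?S x)"
    have M: "?S x = ennreal M"
      using elim unfolding M_def by (intro ennreal_enn2real[symmetric]) (simp only: top.not_eq_extremum infinity_ennreal_def)
    have M0: "M \<ge> 0" by (simp add: M_def)
    have d_bd: "cmod (d i x) \<le> sqrt M * (sqrt (1/2))^i" for i
    proof -
      have "ennreal (2^i * (cmod (d i x))\<^sup>2) \<le> ?S x"
        by (rule ennreal_term_le_suminf)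
      then have "ennreal (2^i * (cmod (d i x))\<^sup>2) \<le> ennreal M" by (simp only: M)
      then have "2^i * (cmod (d i x))\<^sup>2 \<le> M" using M0 by (simp only: ennreal_le_iff)
      then have "(cmod (d i x))\<^sup>2 \<le> M * (1/2)^i" by (simp add: field_simps)
      then have "sqrt ((cmod (d i x))\<^sup>2) \<le> sqrt (M * (1/2)^i)" by (rule real_sqrt_le_mono)
      then show ?thesis by (simp add: real_sqrt_mult real_sqrt_power real_sqrt_divide)
    qed
    have "summable (\<lambda>i. d i x)"
      by (rule summable_comparison_test'[where N = 0 and g = "\<lambda>i. sqrt M * (sqrt (1/2))^i"])
         (use d_bd in \<open>auto intro!: summable_mult summable_geometric simp: real_sqrt_divide\<close>)
    then have "convergent (\<lambda>n. \<Sum>i<n. d i x)"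
      by (simp add: summable_iff_convergent)
    moreover have "(\<Sum>i<n. d i x) = F (r n) x - F (r 0) x" for n
      by (simp add: d_def sum_lessThan_telescope[of "\<lambda>i. F (r i) x"])
    ultimately have "convergent (\<lambda>n. F (r n) x - F (r 0) x)" by simp
    then have "convergent (\<lambda>n. (F (r n) x - F (r 0) x) + F (r 0) x)"
      by (intro convergent_add convergent_const)
    then show ?case by simp
  qed
  \<comment> \<open>Where the subsequence diverges \<open>lim\<close> has no useful value, but this
    happens only on a null set and measurability is unaffected.\<close>
  define G where "G x = lim (\<lambda>i. F (r i) x)" for x
  have G[measurable]: "G \<in> borel_measurable borel" unfolding G_def[abs_def] by measurable
  have "L2_tendsto F G"
    unfolding L2_tendsto_iff
  proof (rule order_tendstoI)
    fix e :: ennreal assume "0 < e"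
    \<comment> \<open>An intermediate real is taken because \<open>e\<close> may be infinite and
      Fatou's lemma yields only a non-strict bound.\<close>
    then obtain e' where e': "0 < ennreal e'" "ennreal e' < e" "e' \<ge> 0"
      by (metis dense ennreal_cases infinity_ennreal_def not_less_iff_gr_or_eq order.strict_trans top.not_eq_extremum top.extremum_strict)
    then have "e' > 0" by simp
    then obtain M where M: "\<And>m n. m \<ge> M \<Longrightarrow> n \<ge> M \<Longrightarrow> L2sq (\<lambda>x. F m x - F n x) < ennreal e'"
      using cauchy by metis
    have "L2sq (\<lambda>x. F n x - G x) \<le> ennreal e'" if n: "n \<ge> M" for n
    proof -
      have "L2sq (\<lambda>x. F n x - G x) \<le> (\<integral>\<^sup>+x. liminf (\<lambda>i. ennreal ((cmod (F n x - F (r i) x))\<^sup>2)) \<partial>lborel)"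
        unfolding L2sq_def
      proof (intro nn_integral_mono_AE)
        show "AE x in lborel. ennreal ((cmod (F n x - G x))\<^sup>2) \<le> liminf (\<lambda>i. ennreal ((cmod (F n x - F (r i) x))\<^sup>2))"
          using conv
        proof eventually_elim
          case (elim x)
          then have "(\<lambda>i. F (r i) x) \<longlonglongrightarrow> G x" by (simp add: G_def convergent_LIMSEQ_iff)
          then have "(\<lambda>i. ennreal ((cmod (F n x - F (r i) x))\<^sup>2)) \<longlonglongrightarrow> ennreal ((cmod (F n x - G x))\<^sup>2)"
            by (intro tendsto_intros)
          from lim_imp_Liminf[OF sequentially_bot this] show ?case by simp
        qed
      qed
      also have "\<dots> \<le> liminf (\<lambda>i. L2sq (\<lambda>x. F n x - F (r i) x))"
        unfolding L2sq_def by (intro nn_integral_liminf) simp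
      also have "\<dots> \<le> liminf (\<lambda>i. ennreal e')"
      proof (intro Liminf_mono eventually_sequentiallyI[of M])
        fix i assume "M \<le> i"
        then show "L2sq (\<lambda>x. F n x - F (r i) x) \<le> ennreal e'"
          using M[of n "r i"] n r_ge(2)[of i] by simp
      qed
      also have "\<dots> = ennreal e'" by (simp add: Liminf_const)
      finally show ?thesis .
    qed
    then show "\<forall>\<^sub>F n in sequentially. L2sq (\<lambda>x. F n x - G x) < e"
      using e' by (intro eventually_sequentiallyI[of M]) (auto intro: le_less_trans)
  qed simp
  with G show thesis by (rule that)
qed

text \<open>The product \<open>a x * b u\<close> is absolutely integrable on the plane, and a kernel
  of modulus at most 1 keeps it so. The kernels in use are products of phases.\<close>

lemma Fubini_bounded_kernel:
  fixes a b :: "real \<Rightarrow> complex" and k :: "real \<Rightarrow> real \<Rightarrow> complex"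
  assumes a: "integrable lborel a" and b: "integrable lborel b"
    and k[measurable]: "(\<lambda>(x, u). k x u) \<in> borel_measurable (borel \<Otimes>\<^sub>M borel)"
    and k1: "\<And>x u. cmod (k x u) \<le> 1"
  shows "(LINT x|lborel. a x * (LINT u|lborel. b u * k x u))
       = (LINT u|lborel. b u * (LINT x|lborel. a x * k x u))"
proof -
  have [measurable]: "a \<in> borel_measurable borel" "b \<in> borel_measurable borel"
    using a b by auto
  have "integrable (lborel \<Otimes>\<^sub>M lborel) (\<lambda>(x, u). a x * b u)"
    by (rule lborel_pair.Fubini_integrable) (use a b in \<open>auto simp: norm_mult\<close>)
  then have "integrable (lborel \<Otimes>\<^sub>M lborel) (\<lambda>(x, u). a x * b u * k x u)"
  proof (rule Bochner_Integration.integrable_bound)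
    show "AE p in lborel \<Otimes>\<^sub>M lborel. norm (case p of (x, u) \<Rightarrow> a x * b u * k x u)
        \<le> norm (case p of (x, u) \<Rightarrow> a x * b u)"
      by (intro AE_I2) (use k1 in \<open>auto simp: norm_mult intro!: mult_left_le\<close>)
  qed measurable
  from lborel_pair.Fubini_integral[OF this] show ?thesis
    by (simp add: mult_ac flip: integral_mult_right_zero)
qed

section \<open>Plancherel\<close>

lemma borel_measurable_cnj [measurable (raw)]:
  "f \<in> borel_measurable M \<Longrightarrow> (\<lambda>x. cnj (f x)) \<in> borel_measurable M"
  by (rule borel_measurable_continuous_on[where f = cnj]) (auto intro: continuous_intros)

lemma ennreal_norm_integral_le:
  fixes f :: "'a \<Rightarrow> 'b::{banach, second_countable_topology}"
  shows "ennreal (norm (integral\<^sup>L M f)) \<le> (\<integral>\<^sup>+x. ennreal (norm (f x)) \<partial>M)"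
  by (cases "integrable M f") (auto intro: integral_norm_bound_ennreal simp: not_integrable_integral_eq)

text \<open>The Fourier transform of the Gaussian is read off from the characteristic function of
  the standard normal distribution.\<close>

lemma integral_iexp_std_normal:
  "(LINT u|lborel. complex_of_real (std_normal_density u) * exp (\<i> * of_real (t * u)))
     = of_real (exp (- t\<^sup>2 / 2))"
proof -
  have "(LINT u|lborel. complex_of_real (std_normal_density u) * exp (\<i> * of_real (t * u)))
      = char std_normal_distribution t"
    unfolding char_def by (subst integral_density) (auto simp: scaleR_conv_of_real)
  then show ?thesis by (simp add: char_std_normal_distribution)
qed

lemma fourier_L1_measurable [measurable]:
  assumes [measurable]: "f \<in> borel_measurable borel"
  shows "fourier_L1 f \<in> borel_measurable borel"
  unfolding fourier_L1_def[abs_def] by measurable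

text \<open>One factor of \<open>|h|^2 = cnj h * h\<close> at a time is expanded as an integral and
  moved outside by Fubini. The remaining integral over \<open>u\<close> is the Gaussian's
  characteristic function at \<open>s * (y - x)\<close>.\<close>

lemma fourier_L1_gauss:
  assumes f: "integrable lborel f"
  shows "complex_of_real (LINT u|lborel. std_normal_density u * (cmod (fourier_L1 f (s * u)))\<^sup>2)
    = (LINT x|lborel. f x * (LINT y|lborel. cnj (f y) * of_real (exp (- (s * (y - x))\<^sup>2 / 2))))"
proof -
  have [measurable]: "f \<in> borel_measurable borel" using f by auto
  define n :: "real \<Rightarrow> complex" where "n u = of_real (std_normal_density u)" for u
  have n: "integrable lborel n" unfolding n_def[abs_def] by (intro integrable_of_real) auto
  then have [measurable]: "n \<in> borel_measurable borel" by auto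
  define e :: "real \<Rightarrow> real \<Rightarrow> complex" where "e x u = exp (- (\<i> * of_real (s * u) * of_real x))" for x u
  have e1: "cmod (e x u) = 1" for x u by (simp add: e_def norm_exp_eq_Re)
  have e_meas[measurable]: "(\<lambda>(x, u). e x u) \<in> borel_measurable (borel \<Otimes>\<^sub>M borel)"
    unfolding e_def by measurable
  have hat: "fourier_L1 f (s * u) = (LINT x|lborel. f x * e x u)" for u
    by (simp add: fourier_L1_def e_def)
  let ?h = "\<lambda>u. fourier_L1 f (s * u)"
  have h_bd: "cmod (?h u) \<le> (LINT x|lborel. cmod (f x))" for u
    unfolding hat by (rule order_trans[OF integral_norm_bound]) (simp add: norm_mult e1)
  \<comment> \<open>The transform is bounded by the integral of \<open>|f|\<close>, so the Gaussian
    weight makes this product integrable, as the outer exchange requires.\<close>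
  have hint: "integrable lborel (\<lambda>u. n u * cnj (?h u))"
  proof (rule Bochner_Integration.integrable_bound)
    show "integrable lborel (\<lambda>u. of_real (LINT x|lborel. cmod (f x)) * n u)"
      by (intro integrable_mult_right n)
    show "AE u in lborel. cmod (n u * cnj (?h u)) \<le> cmod (of_real (LINT x|lborel. cmod (f x)) * n u)"
      by (intro AE_I2) (use h_bd in \<open>auto simp: norm_mult mult.commute[of _ "cmod (n _)"] intro!: mult_left_mono order_trans[OF _ abs_ge_self]\<close>)
  qed measurable
  have inner: "(LINT u|lborel. n u * cnj (?h u) * e x u)
      = (LINT y|lborel. cnj (f y) * of_real (exp (- (s * (y - x))\<^sup>2 / 2)))" for x
  proof -
    have "(LINT u|lborel. n u * cnj (?h u) * e x u)
        = (LINT u|lborel. n u * (LINT y|lborel. cnj (f y) * (cnj (e y u) * e x u)))"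
    proof (intro Bochner_Integration.integral_cong refl)
      fix u
      have "cnj (?h u) * e x u = (LINT y|lborel. cnj (f y * e y u)) * e x u"
        by (simp only: hat Bochner_Integration.integral_cnj)
      also have "\<dots> = (LINT y|lborel. cnj (f y) * (cnj (e y u) * e x u))"
        by (subst integral_mult_left_zero[symmetric]) (simp add: mult.assoc)
      finally show "n u * cnj (?h u) * e x u = n u * (LINT y|lborel. cnj (f y) * (cnj (e y u) * e x u))"
        by (simp only: mult.assoc)
    qed
    also have "\<dots> = (LINT y|lborel. cnj (f y) * (LINT u|lborel. n u * (cnj (e y u) * e x u)))"
      by (rule Fubini_bounded_kernel[symmetric]) (use n f e1 in \<open>auto simp: norm_mult\<close>)
    also have "\<dots> = (LINT y|lborel. cnj (f y) * of_real (exp (- (s * (y - x))\<^sup>2 / 2)))"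
    proof (intro Bochner_Integration.integral_cong refl arg_cong2[where f = "(*)"])
      fix y
      have "cnj (e y u) * e x u = exp (\<i> * of_real (s * (y - x) * u))" for u
        by (simp add: e_def exp_cnj algebra_simps flip: exp_add)
      then show "(LINT u|lborel. n u * (cnj (e y u) * e x u)) = of_real (exp (- (s * (y - x))\<^sup>2 / 2))"
        by (simp add: n_def integral_iexp_std_normal del: of_real_mult)
    qed
    finally show ?thesis .
  qed
  have "complex_of_real (LINT u|lborel. std_normal_density u * (cmod (?h u))\<^sup>2)
      = (LINT u|lborel. n u * cnj (?h u) * ?h u)"
    by (subst integral_complex_of_real[symmetric])
       (simp add: n_def complex_norm_square[unfolded of_real_power] mult_ac)
  also have "\<dots> = (LINT u|lborel. n u * cnj (?h u) * (LINT x|lborel. f x * e x u))"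
    by (simp add: hat)
  also have "\<dots> = (LINT x|lborel. f x * (LINT u|lborel. n u * cnj (?h u) * e x u))"
    by (rule Fubini_bounded_kernel[symmetric]) (use f hint e1 in auto)
  also have "\<dots> = (LINT x|lborel. f x * (LINT y|lborel. cnj (f y) * of_real (exp (- (s * (y - x))\<^sup>2 / 2))))"
    by (simp add: inner)
  finally show ?thesis .
qed

text \<open>The integrand is \<open>sqrt (2 * pi) / s\<close> times the normal density with mean
  \<open>x\<close> and standard deviation \<open>1 / s\<close>.\<close>

lemma nn_integral_gauss:
  assumes "s > 0"
  shows "(\<integral>\<^sup>+y. ennreal (exp (- ((s * (y - x))\<^sup>2 / 2))) \<partial>lborel) = ennreal (sqrt (2 * pi) / s)"
proof -
  have "exp (- ((s * (y - x))\<^sup>2 / 2)) = sqrt (2 * pi) / s * normal_density x (1 / s) y" for y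
    using assms by (simp add: normal_density_def real_sqrt_mult real_sqrt_divide power_mult_distrib power_divide mult_ac)
  then have "(\<integral>\<^sup>+y. ennreal (exp (- ((s * (y - x))\<^sup>2 / 2))) \<partial>lborel)
      = (\<integral>\<^sup>+y. ennreal (sqrt (2 * pi) / s) * ennreal (normal_density x (1 / s) y) \<partial>lborel)"
    using assms by (simp only: ennreal_mult'[OF normal_density_nonneg] ennreal_mult''[OF normal_density_nonneg])
  also have "\<dots> = ennreal (sqrt (2 * pi) / s) * (\<integral>\<^sup>+y. ennreal (normal_density x (1 / s) y) \<partial>lborel)"
    by (rule nn_integral_cmult) simp
  also have "(\<integral>\<^sup>+y. ennreal (normal_density x (1 / s) y) \<partial>lborel) = 1"
    using assms by (subst nn_integral_eq_integral) auto
  finally show ?thesis by simp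
qed

text \<open>A Schur-type estimate: \<open>|f x| |f y|\<close> is at most the mean of the two
  squares, and the symmetric Gaussian kernel has the same total mass in either variable. Each square
  thus contributes half of the bound.\<close>

lemma fourier_L1_gauss_bound:
  assumes f: "integrable lborel f" and s: "s > 0"
  shows "(\<integral>\<^sup>+u. ennreal (std_normal_density u * (cmod (fourier_L1 f (s * u)))\<^sup>2) \<partial>lborel)
    \<le> ennreal (sqrt (2 * pi) / s) * L2sq f"
proof -
  have [measurable]: "f \<in> borel_measurable borel" using f by auto
  let ?E = "\<lambda>x y. exp (- (s * (y - x))\<^sup>2 / 2)"
  let ?c = "ennreal (sqrt (2 * pi) / s)"
  let ?q = "\<lambda>x. ennreal ((cmod (f x))\<^sup>2 / 2)"
  have q: "2 * (\<integral>\<^sup>+x. ?q x \<partial>lborel) = L2sq f"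
    unfolding L2sq_def by (subst nn_integral_cmult[symmetric])
      (auto simp: ennreal_mult[symmetric] ennreal_numeral[symmetric] simp del: ennreal_numeral)
  have hint: "integrable lborel (\<lambda>u. std_normal_density u * (cmod (fourier_L1 f (s * u)))\<^sup>2)"
  proof (rule Bochner_Integration.integrable_bound)
    show "integrable lborel (\<lambda>u. (LINT x|lborel. cmod (f x))\<^sup>2 * std_normal_density u)"
      by (intro integrable_mult_right) auto
    have "cmod (fourier_L1 f t) \<le> (LINT x|lborel. cmod (f x))" for t
      unfolding fourier_L1_def
      by (rule order_trans[OF integral_norm_bound]) (simp add: norm_mult norm_exp_eq_Re)
    then show "AE u in lborel. norm (std_normal_density u * (cmod (fourier_L1 f (s * u)))\<^sup>2)
        \<le> norm ((LINT x|lborel. cmod (f x))\<^sup>2 * std_normal_density u)"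
      by (intro AE_I2) (simp add: mult.commute[of _ "std_normal_density _"] mult_left_mono power_mono)
  qed measurable
  have "(\<integral>\<^sup>+u. ennreal (std_normal_density u * (cmod (fourier_L1 f (s * u)))\<^sup>2) \<partial>lborel)
      = ennreal (norm (complex_of_real (LINT u|lborel. std_normal_density u * (cmod (fourier_L1 f (s * u)))\<^sup>2)))"
    using hint by (subst nn_integral_eq_integral) (auto simp: norm_of_real)
  also have "\<dots> \<le> (\<integral>\<^sup>+x. ennreal (cmod (f x * (LINT y|lborel. cnj (f y) * of_real (?E x y)))) \<partial>lborel)"
    unfolding fourier_L1_gauss[OF f] by (rule ennreal_norm_integral_le)
  also have "\<dots> \<le> (\<integral>\<^sup>+x. \<integral>\<^sup>+y. ?q x * ennreal (?E x y) + ?q y * ennreal (?E x y) \<partial>lborel \<partial>lborel)"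
  proof (intro nn_integral_mono)
    fix x
    have "ennreal (cmod (f x * (LINT y|lborel. cnj (f y) * of_real (?E x y))))
        \<le> ennreal (cmod (f x)) * (\<integral>\<^sup>+y. ennreal (cmod (cnj (f y) * of_real (?E x y))) \<partial>lborel)"
      unfolding norm_mult[of "f x"] ennreal_mult[OF norm_ge_zero norm_ge_zero]
      by (intro mult_left_mono ennreal_norm_integral_le) simp
    also have "\<dots> = (\<integral>\<^sup>+y. ennreal (cmod (f x)) * ennreal (cmod (cnj (f y) * of_real (?E x y))) \<partial>lborel)"
      by (rule nn_integral_cmult[symmetric]) simp
    also have "\<dots> \<le> (\<integral>\<^sup>+y. ?q x * ennreal (?E x y) + ?q y * ennreal (?E x y) \<partial>lborel)"
    proof (intro nn_integral_mono)
      fix y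
      have "cmod (f x) * cmod (f y) \<le> (cmod (f x))\<^sup>2 / 2 + (cmod (f y))\<^sup>2 / 2"
        using zero_le_power2[of "cmod (f x) - cmod (f y)"] by (simp add: power2_diff)
      then have "(cmod (f x) * cmod (f y)) * ?E x y \<le> ((cmod (f x))\<^sup>2 / 2 + (cmod (f y))\<^sup>2 / 2) * ?E x y"
        by (intro mult_right_mono) auto
      then have "cmod (f x) * cmod (cnj (f y) * of_real (?E x y))
          \<le> (cmod (f x))\<^sup>2 / 2 * ?E x y + (cmod (f y))\<^sup>2 / 2 * ?E x y"
        by (simp add: norm_mult algebra_simps)
      from ennreal_leI[OF this]
      show "ennreal (cmod (f x)) * ennreal (cmod (cnj (f y) * of_real (?E x y)))
          \<le> ?q x * ennreal (?E x y) + ?q y * ennreal (?E x y)"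
        by (simp only: ennreal_mult'[symmetric] ennreal_plus[symmetric] norm_ge_zero zero_le_mult_iff
              exp_ge_zero zero_le_power2 zero_le_divide_iff zero_le_numeral simp_thms)
    qed
    finally show "ennreal (cmod (f x * (LINT y|lborel. cnj (f y) * of_real (?E x y))))
        \<le> (\<integral>\<^sup>+y. ?q x * ennreal (?E x y) + ?q y * ennreal (?E x y) \<partial>lborel)" .
  qed
  also have "\<dots> = (\<integral>\<^sup>+x. \<integral>\<^sup>+y. ?q x * ennreal (?E x y) \<partial>lborel \<partial>lborel)
      + (\<integral>\<^sup>+x. \<integral>\<^sup>+y. ?q y * ennreal (?E x y) \<partial>lborel \<partial>lborel)"
    by (simp add: nn_integral_add)
  also have "(\<integral>\<^sup>+x. \<integral>\<^sup>+y. ?q y * ennreal (?E x y) \<partial>lborel \<partial>lborel)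
      = (\<integral>\<^sup>+y. \<integral>\<^sup>+x. ?q y * ennreal (?E x y) \<partial>lborel \<partial>lborel)"
    by (rule lborel_pair.Fubini') measurable
  also have "(\<integral>\<^sup>+y. \<integral>\<^sup>+x. ?q y * ennreal (?E x y) \<partial>lborel \<partial>lborel) = (\<integral>\<^sup>+y. ?q y * ?c \<partial>lborel)"
  proof (intro nn_integral_cong)
    fix y
    have "?E x y = ?E y x" for x by (simp add: power_mult_distrib power2_commute)
    then show "(\<integral>\<^sup>+x. ?q y * ennreal (?E x y) \<partial>lborel) = ?q y * ?c"
      using nn_integral_gauss[OF s, of y] by (simp add: nn_integral_cmult)
  qed
  also have "(\<integral>\<^sup>+x. \<integral>\<^sup>+y. ?q x * ennreal (?E x y) \<partial>lborel \<partial>lborel) = (\<integral>\<^sup>+y. ?q y * ?c \<partial>lborel)"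
    by (simp add: nn_integral_cmult nn_integral_gauss[OF s])
  also have "(\<integral>\<^sup>+y. ?q y * ?c \<partial>lborel) + (\<integral>\<^sup>+y. ?q y * ?c \<partial>lborel) = ?c * (2 * (\<integral>\<^sup>+y. ?q y \<partial>lborel))"
  proof -
    have "a * c + a * c = c * (2 * a)" for a c :: ennreal
      by (metis mult.commute mult.left_commute mult_2)
    moreover have "(\<integral>\<^sup>+y. ?q y * ?c \<partial>lborel) = (\<integral>\<^sup>+y. ?q y \<partial>lborel) * ?c"
      by (rule nn_integral_multc) simp
    ultimately show ?thesis by simp
  qed
  finally show ?thesis by (simp only: q)
qed

text \<open>
  Weighting by a Gaussian of width \<open>s\<close> makes the double integral absolutely convergent; the kernel
  that appears has integral \<open>sqrt (2 * pi) / s\<close>, and \<open>s \<rightarrow> \<infinity>\<close> removes the weight.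
\<close>

lemma Plancherel_le:
  assumes f: "integrable lborel f"
  shows "L2sq (fourier_L1 f) \<le> ennreal (2 * pi) * L2sq f"
proof -
  have [measurable]: "f \<in> borel_measurable borel" using f by auto
  let ?h = "fourier_L1 f"
  let ?N = "\<lambda>n t. ennreal (std_normal_density (t / real (Suc n)) * (cmod (?h t))\<^sup>2)"
  have bd: "(\<integral>\<^sup>+t. ?N n t \<partial>lborel) \<le> ennreal (sqrt (2 * pi)) * L2sq f" for n
  proof -
    define s where "s = real (Suc n)"
    have s: "s > 0" by (simp add: s_def)
    \<comment> \<open>The Jacobian \<open>s\<close> of \<open>t = s * u\<close> cancels the
      \<open>1 / s\<close> in the Gaussian bound, so the estimate is uniform in
      \<open>n\<close>.\<close>
    have "(\<integral>\<^sup>+t. ?N n t \<partial>lborel) = ennreal s * (\<integral>\<^sup>+u. ?N n (0 + s * u) \<partial>lborel)"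
      using s by (subst nn_integral_real_affine[where c = s and t = 0]) auto
    also have "(\<integral>\<^sup>+u. ?N n (0 + s * u) \<partial>lborel)
        = (\<integral>\<^sup>+u. ennreal (std_normal_density u * (cmod (?h (s * u)))\<^sup>2) \<partial>lborel)"
      using s by (simp only: s_def[symmetric] add_0 ennreal_mult'[OF normal_density_nonneg]) simp
    also have "ennreal s * \<dots> \<le> ennreal s * (ennreal (sqrt (2 * pi) / s) * L2sq f)"
      by (intro mult_left_mono fourier_L1_gauss_bound f s) simp
    also have "\<dots> = ennreal (sqrt (2 * pi)) * L2sq f"
      using s by (simp add: mult.assoc[symmetric] ennreal_mult[symmetric])
    finally show ?thesis .
  qed
  \<comment> \<open>The weights converge to \<open>std_normal_density 0 = 1 / sqrt (2 * pi)\<close>.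
    Clearing this factor after Fatou's lemma produces the constant \<open>2 * pi\<close>.\<close>
  have "(\<integral>\<^sup>+t. ennreal (1 / sqrt (2 * pi)) * ennreal ((cmod (?h t))\<^sup>2) \<partial>lborel)
      = (\<integral>\<^sup>+t. liminf (\<lambda>n. ?N n t) \<partial>lborel)"
  proof (intro nn_integral_cong)
    fix t
    have "(\<lambda>n. t / real (Suc n)) \<longlonglongrightarrow> 0" by real_asymp
    moreover have "isCont std_normal_density 0" by (simp add: std_normal_density_def[abs_def])
    ultimately have "(\<lambda>n. std_normal_density (t / real (Suc n))) \<longlonglongrightarrow> std_normal_density 0"
      by (rule isCont_tendsto_compose[rotated])
    then have "(\<lambda>n. ?N n t) \<longlonglongrightarrow> ennreal (std_normal_density 0 * (cmod (?h t))\<^sup>2)"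
      by (intro tendsto_intros)
    from lim_imp_Liminf[OF sequentially_bot this]
    have "liminf (\<lambda>n. ?N n t) = ennreal (std_normal_density 0 * (cmod (?h t))\<^sup>2)" .
    also have "\<dots> = ennreal (1 / sqrt (2 * pi)) * ennreal ((cmod (?h t))\<^sup>2)"
      by (simp only: ennreal_mult'[OF normal_density_nonneg]) (simp add: std_normal_density_def)
    finally show "ennreal (1 / sqrt (2 * pi)) * ennreal ((cmod (?h t))\<^sup>2) = liminf (\<lambda>n. ?N n t)" ..
  qed
  also have "\<dots> \<le> liminf (\<lambda>n. \<integral>\<^sup>+t. ?N n t \<partial>lborel)"
    by (intro nn_integral_liminf) simp
  also have "\<dots> \<le> liminf (\<lambda>n. ennreal (sqrt (2 * pi)) * L2sq f)"
    by (intro Liminf_mono always_eventually allI bd)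
  also have "\<dots> = ennreal (sqrt (2 * pi)) * L2sq f" by (simp add: Liminf_const)
  finally have "ennreal (1 / sqrt (2 * pi)) * L2sq ?h \<le> ennreal (sqrt (2 * pi)) * L2sq f"
    unfolding L2sq_def by (subst (asm) nn_integral_cmult) auto
  then have "ennreal (sqrt (2 * pi)) * (ennreal (1 / sqrt (2 * pi)) * L2sq ?h)
      \<le> ennreal (sqrt (2 * pi)) * (ennreal (sqrt (2 * pi)) * L2sq f)"
    by (rule mult_left_mono) simp
  then show ?thesis
    by (simp add: mult.assoc[symmetric] ennreal_mult[symmetric])
qed

section \<open>Extension of the transform from integrable to square-integrable functions\<close>

lemma fourier_L1_diff:
  assumes "integrable lborel f" "integrable lborel h"
  shows "fourier_L1 (\<lambda>x. f x - h x) = (\<lambda>t. fourier_L1 f t - fourier_L1 h t)"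
proof (rule ext)
  fix t
  have i: "integrable lborel (\<lambda>x. f x * exp (- (\<i> * of_real t * of_real x)))"
    if "integrable lborel f" for f
    by (rule Bochner_Integration.integrable_bound[OF that])
       (use that in \<open>auto simp: norm_mult norm_exp_eq_Re\<close>)
  show "fourier_L1 (\<lambda>x. f x - h x) t = fourier_L1 f t - fourier_L1 h t"
    unfolding fourier_L1_def using i assms by (simp add: left_diff_distrib)
qed

lemma Plancherel_diff_le:
  assumes "integrable lborel f" "integrable lborel h"
  shows "L2sq (\<lambda>t. fourier_L1 f t - fourier_L1 h t) \<le> ennreal (2 * pi) * L2sq (\<lambda>x. f x - h x)"
  using Plancherel_le[of "\<lambda>x. f x - h x"] assms by (simp add: fourier_L1_diff[OF assms])

text \<open>\<open>has_fourier_L2\<close> supplies only some approximating sequence. Plancherel's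
  inequality applied to the difference of two such sequences shows that any other one, in particular
  the damped one, has the same limit.\<close>

lemma L2_tendsto_fourier_L1:
  assumes G: "has_fourier_L2 g G" and g[measurable]: "g \<in> borel_measurable borel"
    and f: "\<And>n. integrable lborel (f n)" "L2_tendsto f g"
  shows "L2_tendsto (\<lambda>n. fourier_L1 (f n)) G"
proof -
  obtain f' where f': "\<And>n. integrable lborel (f' n)" "L2_tendsto f' g"
      "L2_tendsto (\<lambda>n. fourier_L1 (f' n)) G" and GL: "L2_on UNIV G"
    using G unfolding has_fourier_L2_def by blast
  have [measurable]: "f n \<in> borel_measurable borel" "f' n \<in> borel_measurable borel"
      "G \<in> borel_measurable borel" for n
    using f(1) f'(1) GL by (auto simp: L2_on_UNIV_iff)
  show ?thesis
  proof (rule L2_tendsto_shift[OF _ _ _ f'(3)])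
    have bd: "L2sq (\<lambda>t. fourier_L1 (f n) t - fourier_L1 (f' n) t)
        \<le> ennreal (2 * pi) * (2 * L2sq (\<lambda>x. f n x - g x) + 2 * L2sq (\<lambda>x. f' n x - g x))" for n
    proof -
      have "L2sq (\<lambda>t. fourier_L1 (f n) t - fourier_L1 (f' n) t)
          \<le> ennreal (2 * pi) * L2sq (\<lambda>x. f n x - f' n x)"
        by (intro Plancherel_diff_le f f')
      also have "L2sq (\<lambda>x. f n x - f' n x) \<le> 2 * L2sq (\<lambda>x. f n x - g x) + 2 * L2sq (\<lambda>x. f' n x - g x)"
        using L2sq_triangle[of "f n" g "f' n"] by (simp add: L2sq_minus_commute[of g])
      finally show ?thesis by (simp add: mult_left_mono)
    qed
    have "(\<lambda>n. ennreal (2 * pi) * (2 * L2sq (\<lambda>x. f n x - g x) + 2 * L2sq (\<lambda>x. f' n x - g x)))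
        \<longlonglongrightarrow> ennreal (2 * pi) * (2 * 0 + 2 * 0)"
      using f(2) f'(2) unfolding L2_tendsto_iff
      by (intro tendsto_add ennreal_tendsto_cmult) auto
    then have lim: "(\<lambda>n. ennreal (2 * pi) * (2 * L2sq (\<lambda>x. f n x - g x) + 2 * L2sq (\<lambda>x. f' n x - g x)))
        \<longlonglongrightarrow> 0" by simp
    show "(\<lambda>n. L2sq (\<lambda>t. fourier_L1 (f n) t - fourier_L1 (f' n) t)) \<longlonglongrightarrow> 0"
      by (rule tendsto_sandwich[OF _ _ tendsto_const lim]) (use bd in auto)
  qed auto
qed

text \<open>This ensures that the choice in \<open>fourier_L2\<close> picks a genuine transform:
  Plancherel's inequality carries the Cauchy property of \<open>f\<close> over to the
  transforms.\<close>

lemma has_fourier_L2_exists: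
  assumes g[measurable]: "g \<in> borel_measurable borel"
    and f: "\<And>n. integrable lborel (f n)" "\<And>n. L2_on UNIV (f n)" "L2_tendsto f g"
  shows "\<exists>G. has_fourier_L2 g G"
proof -
  have [measurable]: "f n \<in> borel_measurable borel" for n using f(1) by auto
  let ?F = "\<lambda>n. fourier_L1 (f n)"
  obtain G where G: "G \<in> borel_measurable borel" "L2_tendsto ?F G"
  proof (rule L2_complete[of ?F])
    fix e :: real assume e: "e > 0"
    \<comment> \<open>Chosen so that \<open>2 * pi * (2 * d + 2 * d) = e / 2\<close>, which is
      strictly below \<open>e\<close>.\<close>
    define d where "d = e / (16 * pi)"
    have "d > 0" using e by (simp add: d_def)
    then have "\<forall>\<^sub>F n in sequentially. L2sq (\<lambda>x. f n x - g x) < ennreal d"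
      using f(3) unfolding L2_tendsto_iff by (intro order_tendstoD) auto
    then obtain N where N: "\<And>n. n \<ge> N \<Longrightarrow> L2sq (\<lambda>x. f n x - g x) < ennreal d"
      by (auto simp: eventually_sequentially)
    show "\<exists>N. \<forall>m\<ge>N. \<forall>n\<ge>N. L2sq (\<lambda>x. ?F m x - ?F n x) < ennreal e"
    proof (intro exI allI impI)
      fix m n assume mn: "N \<le> m" "N \<le> n"
      have "L2sq (\<lambda>t. ?F m t - ?F n t) \<le> ennreal (2 * pi) * L2sq (\<lambda>x. f m x - f n x)"
        by (intro Plancherel_diff_le f)
      also have "\<dots> \<le> ennreal (2 * pi) * (2 * L2sq (\<lambda>x. f m x - g x) + 2 * L2sq (\<lambda>x. f n x - g x))"
        using L2sq_triangle[of "f m" g "f n"] by (intro mult_left_mono) (simp_all add: L2sq_minus_commute[of g])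
      also have "\<dots> \<le> ennreal (2 * pi) * (2 * ennreal d + 2 * ennreal d)"
        using N mn by (intro mult_left_mono add_mono) (auto intro: less_imp_le)
      also have "\<dots> = ennreal (e / 2)"
      proof -
        have "2 * ennreal d + 2 * ennreal d = ennreal (4 * d)"
          using \<open>d > 0\<close> by (simp add: ennreal_mult ennreal_plus[symmetric] distrib_right[symmetric])
        then show ?thesis
          using \<open>d > 0\<close> by (simp add: ennreal_mult[symmetric] d_def)
      qed
      also have "\<dots> < ennreal e" using e by (simp add: ennreal_lessI)
      finally show "L2sq (\<lambda>x. ?F m x - ?F n x) < ennreal e" .
    qed
  qed auto
  note [measurable] = G(1)
  have "L2sq G < \<infinity>"
  proof -
    have "\<forall>\<^sub>F n in sequentially. L2sq (\<lambda>x. ?F n x - G x) < 1"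
      using G(2) unfolding L2_tendsto_iff by (intro order_tendstoD) auto
    \<comment> \<open>A single transform at finite distance from \<open>G\<close> suffices for
      \<open>G\<close> to be square integrable.\<close>
    then obtain n where n: "L2sq (\<lambda>x. ?F n x - G x) < 1"
      by (auto simp: eventually_sequentially)
    have "L2sq (?F n) \<le> ennreal (2 * pi) * L2sq (f n)" by (intro Plancherel_le f)
    also have "\<dots> < \<infinity>" using f(2)[of n] by (simp add: L2_on_UNIV_iff ennreal_mult_less_top)
    finally have Fn: "L2sq (?F n) < \<infinity>" .
    have "L2sq G \<le> 2 * L2sq (\<lambda>x. G x - ?F n x) + 2 * L2sq (?F n)"
      using L2sq_add_le[of "\<lambda>x. G x - ?F n x" "?F n"] by simp
    also have "\<dots> < \<infinity>"
      using n Fn by (auto simp: L2sq_minus_commute[of G] ennreal_mult_less_top intro: less_trans)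
    finally show ?thesis .
  qed
  then have "has_fourier_L2 g G"
    unfolding has_fourier_L2_def using f G by (intro conjI exI[of _ f]) (auto simp: L2_on_UNIV_iff)
  then show ?thesis by blast
qed

section \<open>Laplace transforms and rotation of the contour\<close>

text \<open>Up to the factor \<open>c\<close> this is the density of the exponential distribution,
  whose total mass is 1.\<close>

lemma integrable_exp_halfline:
  assumes "c > 0"
  shows "integrable lborel (\<lambda>x::real. indicator {0..} x * exp (- (c * x)))"
proof -
  interpret prob_space "density lborel (exponential_density c)"
    by (rule prob_space_exponential_density) fact
  have "(\<integral>\<^sup>+x. ennreal (exponential_density c x) \<partial>lborel) = 1"
    using emeasure_space_1 by (simp add: emeasure_density)
  then have "integrable lborel (exponential_density c)"
    using assms by (intro integrableI_nonneg) (auto simp: erlang_density_nonneg)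
  then have "integrable lborel (\<lambda>x. inverse c * exponential_density c x)"
    by (rule integrable_mult_right)
  also have "(\<lambda>x. inverse c * exponential_density c x) = (\<lambda>x. indicator {0..} x * exp (- (c * x)))"
    using assms by (auto simp: exponential_density_def indicator_def mult.commute)
  finally show ?thesis .
qed

lemma integrable_exp_abs:
  assumes "c > 0"
  shows "integrable lborel (\<lambda>x::real. exp (- (c * \<bar>x\<bar>)))"
proof -
  let ?f = "\<lambda>x::real. indicator {0..} x * exp (- (c * x))"
  have f: "integrable lborel ?f" by (rule integrable_exp_halfline) fact
  have "integrable lborel (\<lambda>x. ?f (0 + (-1) * x))"
    by (rule lborel_integrable_real_affine[OF f]) simp
  with f have "integrable lborel (\<lambda>x. ?f x + ?f (0 + (-1) * x))" by (rule Bochner_Integration.integrable_add)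
  then show ?thesis
    by (rule Bochner_Integration.integrable_bound) (auto simp: indicator_def)
qed

lemma integral_split_halflines:
  fixes h :: "real \<Rightarrow> complex"
  assumes h: "integrable lborel h"
  shows "(LINT x|lborel. h x) = (LINT x:{0..}|lborel. h x) + (LINT x:{0..}|lborel. h (- x))"
proof -
  have [measurable]: "h \<in> borel_measurable borel" using h by auto
  have ind: "integrable lborel (\<lambda>x. indicator S x *\<^sub>R h x)" if "S \<in> sets borel" for S
    using h that by (intro integrable_mult_indicator) auto
  have "(LINT x|lborel. h x) = (LINT x|lborel. indicator {0..} x *\<^sub>R h x + indicator {..<0} x *\<^sub>R h x)"
    by (intro Bochner_Integration.integral_cong) (auto simp: indicator_def)
  also have "\<dots> = (LINT x|lborel. indicator {0..} x *\<^sub>R h x) + (LINT x|lborel. indicator {..<0} x *\<^sub>R h x)"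
    by (intro Bochner_Integration.integral_add ind) auto
  also have "(LINT x|lborel. indicator {..<0} x *\<^sub>R h x)
      = (LINT x|lborel. indicator {..<0} (0 + (-1) * x) *\<^sub>R h (0 + (-1) * x))"
    by (subst lborel_integral_real_affine[where c = "-1" and t = 0]) auto
  also have "\<dots> = (LINT x|lborel. indicator {0..} x *\<^sub>R h (- x))"
  proof (rule integral_cong_AE)
    \<comment> \<open>Reflection turns \<open>{..<0}\<close> into \<open>{0<..}\<close>, which
      misses only the null point 0.\<close>
    show "AE x in lborel. indicator {..<0} (0 + (-1) * x) *\<^sub>R h (0 + (-1) * x) = indicator {0..} x *\<^sub>R h (- x)"
      using AE_lborel_singleton[of "0::real"] by eventually_elim (auto simp: indicator_def)
  qed measurable
  finally show ?thesis by (simp add: set_lebesgue_integral_def)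
qed

text \<open>Differentiation under the integral sign: along any sequence tending to \<open>s\<close>
  inside a small ball, the difference quotients are dominated by an integrable function.\<close>

lemma Laplace_transform_holomorphic:
  fixes H :: "real \<Rightarrow> complex"
  assumes int: "\<And>a. a > A \<Longrightarrow> integrable lborel (\<lambda>x. exp (- (a * x)) *\<^sub>R H x)"
    and neg: "\<And>x. x < 0 \<Longrightarrow> H x = 0"
  shows "(\<lambda>s. LINT x|lborel. H x * exp (- (s * of_real x))) holomorphic_on {s. Re s > A}"
proof -
  let ?L = "\<lambda>s. LINT x|lborel. H x * exp (- (s * of_real x))"
  \<comment> \<open>Measurability of \<open>H\<close> is recovered by undoing the exponential weight
    at one admissible exponent, \<open>A + 1\<close>.\<close>
  have H[measurable]: "H \<in> borel_measurable borel"
  proof -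
    have [measurable]: "(\<lambda>x. exp (- ((A + 1) * x)) *\<^sub>R H x) \<in> borel_measurable borel"
      using int[of "A + 1"] by auto
    have "(\<lambda>x. exp ((A + 1) * x) *\<^sub>R (exp (- ((A + 1) * x)) *\<^sub>R H x)) \<in> borel_measurable borel"
      by (rule borel_measurable_scaleR) measurable
    then show ?thesis
      by (simp only: scaleR_scaleR exp_add[symmetric] add.right_inverse exp_zero scaleR_one)
  qed
  have intL: "integrable lborel (\<lambda>x. H x * exp (- (s * of_real x)))" if "Re s > A" for s
    by (rule Bochner_Integration.integrable_bound[OF int[OF that]])
       (auto simp: norm_mult mult.commute)
  have "?L field_differentiable at s" if s: "Re s > A" for s
  proof -
    \<comment> \<open>The margin is split in three: one \<open>d\<close> is the radius of the ball,
      one absorbs the factor \<open>x\<close> through \<open>x \<le> exp (d * x) / d\<close>, and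
      the last keeps the exponent \<open>Re s - 2 * d\<close> above \<open>A\<close>.\<close>
    define d where "d = (Re s - A) / 3"
    have "3 * d = Re s - A" by (simp add: d_def)
    then have d: "d > 0" "Re s - 2 * d > A" using s by linarith+
    let ?B = "ball s d"
    let ?D = "\<lambda>x. H x * (- of_real x * exp (- (s * of_real x)))"
    let ?w = "\<lambda>x. (1 / d) * norm (exp (- ((Re s - 2 * d) * x)) *\<^sub>R H x)"
    have "((\<lambda>u. (?L u - ?L s) / (u - s)) \<longlongrightarrow> (LINT x|lborel. ?D x)) (at s within ?B)"
      unfolding tendsto_at_iff_sequentially
    proof (intro allI impI)
      fix X assume X: "\<forall>i. X i \<in> ?B - {s}" "X \<longlonglongrightarrow> s"
      have XB: "X i \<in> ?B" "X i \<noteq> s" for i using X by auto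
      have XA: "Re (X i) > A" for i
        using abs_Re_le_cmod[of "s - X i"] XB[of i] d by (auto simp: dist_norm)
      have "(\<lambda>i. LINT x|lborel. H x * ((exp (- (X i * of_real x)) - exp (- (s * of_real x))) / (X i - s)))
          \<longlonglongrightarrow> (LINT x|lborel. ?D x)"
      proof (rule integral_dominated_convergence[where w = ?w])
        show "integrable lborel ?w" using d by (intro integrable_mult_right integrable_norm int)
        show "AE x in lborel. (\<lambda>i. H x * ((exp (- (X i * of_real x)) - exp (- (s * of_real x))) / (X i - s)))
            \<longlonglongrightarrow> ?D x"
        proof (intro AE_I2 tendsto_mult tendsto_const)
          fix x :: real
          have "((\<lambda>u. exp (- (u * of_real x))) has_field_derivative (- of_real x * exp (- (s * of_real x)))) (at s within ?B)"
            by (auto intro!: derivative_eq_intros)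
          then show "(\<lambda>i. (exp (- (X i * of_real x)) - exp (- (s * of_real x))) / (X i - s))
              \<longlonglongrightarrow> - of_real x * exp (- (s * of_real x))"
            using X unfolding has_field_derivative_iff tendsto_at_iff_sequentially by (auto simp: o_def)
        qed
        fix i
        show "AE x in lborel. norm (H x * ((exp (- (X i * of_real x)) - exp (- (s * of_real x))) / (X i - s))) \<le> ?w x"
        proof (intro AE_I2)
          fix x :: real
          show "norm (H x * ((exp (- (X i * of_real x)) - exp (- (s * of_real x))) / (X i - s))) \<le> ?w x"
          proof (cases "x < 0")
            case False
            have "norm (exp (- (X i * of_real x)) - exp (- (s * of_real x)))
                \<le> (x * exp (- ((Re s - d) * x))) * norm (X i - s)"
            proof (rule field_differentiable_bound[of ?B])
              fix z assume z: "z \<in> ?B"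
              show "((\<lambda>u. exp (- (u * of_real x))) has_field_derivative (- of_real x * exp (- (z * of_real x)))) (at z within ?B)"
                by (auto intro!: derivative_eq_intros)
              have "Re z \<ge> Re s - d"
                using abs_Re_le_cmod[of "s - z"] z by (auto simp: dist_norm)
              then have "(Re s - d) * x \<le> Re z * x" using False by (intro mult_right_mono) auto
              then show "norm (- of_real x * exp (- (z * of_real x))) \<le> x * exp (- ((Re s - d) * x))"
                using False by (auto simp: norm_mult intro!: mult_left_mono)
            qed (use XB d in auto)
            then have q: "norm ((exp (- (X i * of_real x)) - exp (- (s * of_real x))) / (X i - s))
                \<le> x * exp (- ((Re s - d) * x))"
              using XB(2)[of i] by (simp add: norm_divide field_simps)
            have "d * x \<le> exp (d * x)"
              using exp_ge_add_one_self[of "d * x"] by linarith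
            then have "x \<le> exp (d * x) / d"
              using d by (simp add: field_simps)
            then have "x * exp (- ((Re s - d) * x)) \<le> exp (d * x) / d * exp (- ((Re s - d) * x))"
              by (intro mult_right_mono) auto
            also have "\<dots> = (1 / d) * exp (- ((Re s - 2 * d) * x))"
              by (simp add: algebra_simps flip: exp_add)
            finally have "norm ((exp (- (X i * of_real x)) - exp (- (s * of_real x))) / (X i - s))
                \<le> (1 / d) * exp (- ((Re s - 2 * d) * x))" using q by linarith
            then have "norm (H x) * norm ((exp (- (X i * of_real x)) - exp (- (s * of_real x))) / (X i - s))
                \<le> norm (H x) * ((1 / d) * exp (- ((Re s - 2 * d) * x)))"
              by (intro mult_left_mono) auto
            then show ?thesis by (simp only: norm_mult norm_scaleR) (simp add: mult_ac)
          qed (simp add: neg)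
        qed
      qed measurable
      moreover have "(LINT x|lborel. H x * ((exp (- (X i * of_real x)) - exp (- (s * of_real x))) / (X i - s)))
          = (?L (X i) - ?L s) / (X i - s)" for i
      proof -
        have "?L (X i) - ?L s = (LINT x|lborel. H x * exp (- (X i * of_real x)) - H x * exp (- (s * of_real x)))"
          by (intro Bochner_Integration.integral_diff[symmetric] intL XA s)
        then show ?thesis
          by (simp add: right_diff_distrib flip: integral_divide_zero)
      qed
      ultimately show "((\<lambda>u. (?L u - ?L s) / (u - s)) \<circ> X) \<longlonglongrightarrow> (LINT x|lborel. ?D x)"
        by (simp only: o_def)
    qed
    then have "((\<lambda>u. (?L u - ?L s) / (u - s)) \<longlongrightarrow> (LINT x|lborel. ?D x)) (at s)"
      using d at_within_open[of s ?B] by simp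
    then show ?thesis
      unfolding field_differentiable_def has_field_derivative_iff by blast
  qed
  then show ?thesis
    by (auto simp: holomorphic_on_def intro: field_differentiable_at_within)
qed

section \<open>Rotation of the contour\<close>

text \<open>
  The ball around 0 makes the domain starlike with respect to 0, so that \<open>u\<close> has a primitive at the
  common starting point of both rays.
\<close>

lemma integral_ray_eq:
  fixes u :: "complex \<Rightarrow> complex"
  assumes hol: "u holomorphic_on ({z. Im z > 0} \<union> ball 0 r)" and r: "r > 0"
    and v: "Im v > 0" and w: "Im w > 0" and c: "c > 0"
    and bound: "\<And>z t. z \<in> closed_segment v w \<Longrightarrow> t > 0 \<Longrightarrow> cmod (u (of_real t * z)) \<le> B * exp (- (c * t))"
  shows "(LINT t:{0..}|lborel. u (of_real t * v) * v) = (LINT t:{0..}|lborel. u (of_real t * w) * w)"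
proof -
  let ?S = "{z. Im z > 0} \<union> ball 0 r"
  have "open {z. Im z > 0}" by (simp add: open_halfspace_Im_gt)
  then have S: "open ?S" by blast
  have ray: "of_real t * z \<in> ?S" if "Im z > 0" "t \<ge> 0" for t z
    using that r by (cases "t = 0") auto
  have "starlike ?S"
    unfolding starlike_def
  proof (intro bexI ballI)
    show "0 \<in> ?S" using r by simp
    fix x assume "x \<in> ?S"
    then show "closed_segment 0 x \<subseteq> ?S"
    proof
      assume "x \<in> {z. Im z > 0}"
      then have x: "Im x > 0" by simp
      show ?thesis
      proof
        fix y assume "y \<in> closed_segment 0 x"
        then obtain t where "y = of_real t * x" "t \<ge> 0"
          by (auto simp: closed_segment_def scaleR_conv_of_real)
        then show "y \<in> ?S" using ray[OF x] by blast
      qed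
    next
      assume "x \<in> ball 0 r"
      then have "closed_segment 0 x \<subseteq> ball 0 r"
        using r by (intro closed_segment_subset) auto
      then show ?thesis by blast
    qed
  qed
  then have "\<exists>U. \<forall>z\<in>?S. (U has_field_derivative u z) (at z)"
    using S hol holomorphic_on_imp_continuous_on[OF hol] holomorphic_on_imp_differentiable_at[OF hol S]
    by (intro holomorphic_starlike_primitive[of ?S u "{}"]) auto
  then obtain U where U: "\<And>z. z \<in> ?S \<Longrightarrow> (U has_field_derivative u z) (at z)" by blast
  have cont: "continuous_on {0..} (\<lambda>t. u (of_real t * z) * z)" if "Im z > 0" for z
    by (intro continuous_intros continuous_on_compose2[OF holomorphic_on_imp_continuous_on[OF hol]]
          image_subsetI ray that) simp
  have tail: "((\<lambda>R. U (of_real R * z) - U 0) \<longlongrightarrow> (LINT t:{0..}|lborel. u (of_real t * z) * z)) at_top"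
    if z: "z \<in> closed_segment v w" "Im z > 0" for z
  proof -
    have "set_integrable lborel {0..} (\<lambda>t. u (of_real t * z) * z)"
      unfolding set_integrable_def
    proof (rule Bochner_Integration.integrable_bound)
      show "integrable lborel (\<lambda>t. (B * cmod z) * (indicator {0..} t * exp (- (c * t))))"
        by (intro integrable_mult_right integrable_exp_halfline c)
      show "(\<lambda>t. indicator {0..} t *\<^sub>R (u (of_real t * z) * z)) \<in> borel_measurable lborel"
        using borel_measurable_continuous_on_indicator[OF _ cont[OF z(2)]] by simp
      show "AE t in lborel. norm (indicator {0..} t *\<^sub>R (u (of_real t * z) * z))
          \<le> norm ((B * cmod z) * (indicator {0..} t * exp (- (c * t))))"
        using AE_lborel_singleton[of "0::real"]
      proof eventually_elim
        case (elim t)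
        show ?case
        proof (cases "t > 0")
          case True
          have "cmod (u (of_real t * z)) * cmod z \<le> B * exp (- (c * t)) * cmod z"
            by (intro mult_right_mono bound z True) auto
          also have "\<dots> \<le> \<bar>B * exp (- (c * t)) * cmod z\<bar>" by (rule abs_ge_self)
          finally show ?thesis using True by (simp add: norm_mult abs_mult mult_ac)
        qed (use elim in \<open>auto simp: indicator_def\<close>)
      qed
    qed
    then have "((\<lambda>R. LINT t:{0..R}|lborel. u (of_real t * z) * z)
        \<longlongrightarrow> (LINT t:{0..}|lborel. u (of_real t * z) * z)) at_top"
      by (intro tendsto_set_lebesgue_integral_at_top) auto
    moreover have "\<forall>\<^sub>F R in at_top. (LINT t:{0..R}|lborel. u (of_real t * z) * z) = U (of_real R * z) - U 0"
      using eventually_ge_at_top[of "0::real"]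
    proof eventually_elim
      case (elim R)
      have "(LINT t|lborel. indicator {0..R} t *\<^sub>R (u (of_real t * z) * z))
          = U (of_real R * z) - U (of_real 0 * z)"
      proof (rule integral_FTC_Icc)
        fix t assume t: "0 \<le> t" "t \<le> R"
        have "((\<lambda>t. of_real t * z) has_vector_derivative z) (at t within {0..R})"
          by (auto intro!: derivative_eq_intros simp: scaleR_conv_of_real)
        then show "((\<lambda>t. U (of_real t * z)) has_vector_derivative u (of_real t * z) * z) (at t within {0..R})"
          using field_vector_diff_chain_within[of "\<lambda>t. of_real t * z" z t "{0..R}" U "u (of_real t * z)"]
            has_field_derivative_at_within[OF U[OF ray[OF z(2) t(1)]]] by (simp add: o_def mult.commute)
      next
        show "continuous_on {0..R} (\<lambda>t. u (of_real t * z) * z)"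
          by (rule continuous_on_subset[OF cont[OF z(2)]]) auto
      qed (use elim in auto)
      then show ?case
        by (simp only: set_lebesgue_integral_def of_real_0 mult_zero_left)
    qed
    ultimately show ?thesis by (rule Lim_transform_eventually)
  qed
  \<comment> \<open>The contour is closed by the chord from \<open>R * v\<close> to
    \<open>R * w\<close>. Its length is \<open>R * cmod (v - w)\<close>, and \<open>u\<close> is at
    most \<open>B * exp (- (c * R))\<close> on it, so its contribution vanishes.\<close>
  have "((\<lambda>R. (U (of_real R * v) - U 0) - (U (of_real R * w) - U 0)) \<longlongrightarrow> 0) at_top"
  proof (rule Lim_null_comparison)
    have diff_le: "cmod (U (of_real R * v) - U (of_real R * w)) \<le> (B * exp (- (c * R))) * cmod (of_real R * v - of_real R * w)"
      if R: "R > 0" for R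
    proof (rule field_differentiable_bound[where f = U and f' = u and S = "(*) (of_real R) ` closed_segment v w"])
      show "convex ((*) (complex_of_real R) ` closed_segment v w)"
        by (intro convex_linear_image) (auto intro: bounded_linear.linear bounded_linear_mult_right)
      fix z assume "z \<in> (*) (complex_of_real R) ` closed_segment v w"
      then obtain z' where z': "z = of_real R * z'" "z' \<in> closed_segment v w" by auto
      have "closed_segment v w \<subseteq> {z. Im z > 0}"
        using v w by (intro closed_segment_subset convex_halfspace_Im_gt) auto
      then have "Im z' > 0" using z' by auto
      then have "z \<in> ?S"
        unfolding z'(1) using R by (intro ray) auto
      from U[OF this] show "(U has_field_derivative u z) (at z within (*) (complex_of_real R) ` closed_segment v w)"
        by (rule has_field_derivative_at_within)
      show "cmod (u z) \<le> B * exp (- (c * R))" using bound z' R by simp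
    qed auto
    show "\<forall>\<^sub>F R in at_top. norm ((U (of_real R * v) - U 0) - (U (of_real R * w) - U 0))
        \<le> B * cmod (v - w) * (R * exp (- (c * R)))"
      using eventually_gt_at_top[of "0::real"]
    proof eventually_elim
      case (elim R)
      then have "cmod (of_real R * v - of_real R * w) = R * cmod (v - w)"
        by (simp add: norm_mult flip: right_diff_distrib)
      then show ?case using diff_le[OF elim] by (simp add: mult_ac)
    qed
    show "((\<lambda>R. B * cmod (v - w) * (R * exp (- (c * R)))) \<longlongrightarrow> 0) at_top"
      using c by real_asymp
  qed
  moreover have "((\<lambda>R. (U (of_real R * v) - U 0) - (U (of_real R * w) - U 0)) \<longlongrightarrow>
      (LINT t:{0..}|lborel. u (of_real t * v) * v) - (LINT t:{0..}|lborel. u (of_real t * w) * w)) at_top"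
    using v w by (intro tendsto_diff[OF tail tail]) auto
  ultimately show ?thesis
    using tendsto_unique[OF trivial_limit_at_top_linorder] by fastforce
qed


text \<open>The growth bound is available only in the open half-plane, so the rotation is done from
  nearby rays and the rays are then lowered onto the real axis. On the segments used
  \<open>cmod z\<close> is at most 2, whence the threshold \<open>2 * A\<close>.\<close>

lemma integral_ray_eq_real_limit:
  fixes g :: "complex \<Rightarrow> complex" and e :: real
  assumes hol: "g holomorphic_on ({z. Im z > 0} \<union> ball 0 r)" and r: "r > 0"
    and growth: "\<And>z. Im z > 0 \<Longrightarrow> cmod (g z) \<le> C * exp (A * cmod z)" and C: "C > 0" and A: "A > 0"
    and cont: "\<And>x::real. \<bar>x\<bar> \<noteq> k \<Longrightarrow> isCont g (of_real x)"
    and e: "\<bar>e\<bar> = 1" and tau: "Re \<tau> > 2 * A" "e * Im \<tau> > 2 * A"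
  shows "(LINT t:{0..}|lborel. g (of_real (e * t)) * exp (\<i> * \<tau> * of_real (e * t)) * of_real e)
       = (LINT t:{0..}|lborel. g (of_real t * \<i>) * exp (- (\<tau> * of_real t)) * \<i>)"
proof -
  define u where "u z = g z * exp (\<i> * \<tau> * z)" for z
  define v where "v n = Complex e (1 / real (Suc n))" for n
  define c where "c = min (Re \<tau>) (e * Im \<tau>) - 2 * A"
  have c: "c > 0" using tau by (simp add: c_def)
  have uhol: "u holomorphic_on ({z. Im z > 0} \<union> ball 0 r)"
    unfolding u_def by (intro holomorphic_intros hol)
  have v_norm: "cmod (v n) \<le> 2" for n
    using cmod_le[of "v n"] e by (simp add: v_def order.trans)
  have bound: "cmod (u (of_real t * z)) \<le> C * exp (- (c * t))"
    if z: "z \<in> closed_segment (v n) \<i>" and t: "t > 0" for z t n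
  proof -
    obtain l where l: "0 \<le> l" "l \<le> 1" and zl: "z = (1 - l) *\<^sub>R v n + l *\<^sub>R \<i>"
      using z by (auto simp: closed_segment_def)
    have "Im (v n) > 0" by (simp add: v_def)
    then have Imz: "Im z > 0" "Im z \<ge> l" using l
      by (auto simp: zl intro: add_nonneg_pos add_pos_nonneg) (cases "l = 1"; simp add: add_pos_nonneg)
    have Rez: "Re z = (1 - l) * e" by (simp add: zl v_def)
    have "cmod z \<le> (1 - l) * cmod (v n) + l * 1"
      unfolding zl using l by (intro order_trans[OF norm_triangle_ineq]) simp
    also have "\<dots> \<le> (1 - l) * 2 + l * 2" using v_norm l by (intro add_mono mult_left_mono) auto
    finally have nz: "cmod z \<le> 2" by simp
    define m where "m = min (Re \<tau>) (e * Im \<tau>)"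
    have m: "m > 0" "m \<le> Re \<tau>" "m \<le> e * Im \<tau>" using tau A by (auto simp: m_def)
    \<comment> \<open>Since \<open>Re z = (1 - l) * e\<close>, the right side is
      \<open>Im (\<tau> * z)\<close>. The phase thus decays at rate at least \<open>m\<close> on
      every ray through the segment, near the real direction through \<open>Im \<tau>\<close> and
      near \<open>\<i>\<close> through \<open>Re \<tau>\<close>.\<close>
    have "m * l + (1 - l) * m \<le> Re \<tau> * Im z + (1 - l) * (e * Im \<tau>)"
      using m l Imz by (intro add_mono mult_mono) auto
    then have "m \<le> Im (\<tau> * z)" by (simp add: Rez algebra_simps)
    then have mt: "m * t \<le> Im (\<tau> * z) * t" using t by (intro mult_right_mono) auto
    have "cmod (g (of_real t * z)) \<le> C * exp (A * cmod (of_real t * z))"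
      using Imz t by (intro growth) simp
    also have "\<dots> \<le> C * exp (2 * A * t)"
      using C A t nz mult_left_mono[OF nz, of "A * t"] by (simp add: norm_mult mult_ac)
    finally have "cmod (u (of_real t * z)) \<le> C * exp (2 * A * t) * exp (- (m * t))"
      unfolding u_def norm_mult using C mt
      by (intro mult_mono) (auto simp: algebra_simps)
    then show ?thesis by (simp add: c_def m_def algebra_simps flip: exp_add)
  qed
  have eq: "(LINT t:{0..}|lborel. u (of_real t * v n) * v n) = (LINT t:{0..}|lborel. u (of_real t * \<i>) * \<i>)" for n
    by (rule integral_ray_eq[OF uhol r _ _ c bound]) (auto simp: v_def)
  have "(\<lambda>n. LINT t:{0..}|lborel. u (of_real t * v n) * v n)
      \<longlonglongrightarrow> (LINT t:{0..}|lborel. u (of_real (e * t)) * of_real e)"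
    unfolding set_lebesgue_integral_def
  proof (rule integral_dominated_convergence[where w = "\<lambda>t. 2 * C * (indicator {0..} t * exp (- (c * t)))"])
    show "integrable lborel (\<lambda>t. 2 * C * (indicator {0..} t * exp (- (c * t))))"
      by (intro integrable_mult_right integrable_exp_halfline c)
    have "isCont (\<lambda>x. u (of_real x)) x" if "\<bar>x\<bar> \<noteq> k" for x :: real
    proof -
      have "isCont u (of_real x)"
        unfolding u_def by (intro continuous_intros cont that)
      moreover have "isCont complex_of_real x"
        by (intro linear_continuous_at bounded_linear_of_real)
      ultimately show ?thesis by (rule isCont_o2[rotated])
    qed
    then have "continuous_on (- {k, -k}) (\<lambda>x. u (of_real x))"
      by (intro continuous_at_imp_continuous_on ballI) auto
    then have [measurable]: "(\<lambda>x. u (of_real x)) \<in> borel_measurable borel"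
      by (intro borel_measurable_continuous_countable_exceptions[of "{k, -k}"]) auto
    show "(\<lambda>t. indicator {0..} t *\<^sub>R (u (of_real (e * t)) * of_real e)) \<in> borel_measurable lborel"
      by measurable
    show "(\<lambda>t. indicator {0..} t *\<^sub>R (u (of_real t * v n) * v n)) \<in> borel_measurable lborel" for n
    proof -
      have "continuous_on {0..} (\<lambda>t. u (of_real t * v n) * v n)"
      proof (intro continuous_intros continuous_on_compose2[OF holomorphic_on_imp_continuous_on[OF uhol]])
        show "(\<lambda>t. of_real t * v n) ` {0..} \<subseteq> {z. Im z > 0} \<union> ball 0 r"
        proof (intro image_subsetI)
          fix t :: real assume "t \<in> {0..}"
          then show "of_real t * v n \<in> {z. Im z > 0} \<union> ball 0 r"
            using r by (cases "t = 0") (auto simp: v_def)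
        qed
      qed
      from borel_measurable_continuous_on_indicator[OF _ this] show ?thesis by simp
    qed
    show "AE t in lborel. norm (indicator {0..} t *\<^sub>R (u (of_real t * v n) * v n))
        \<le> 2 * C * (indicator {0..} t * exp (- (c * t)))" for n
      using AE_lborel_singleton[of "0::real"]
    proof eventually_elim
      case (elim t)
      show ?case
      proof (cases "t > 0")
        case True
        have "cmod (u (of_real t * v n)) * cmod (v n) \<le> C * exp (- (c * t)) * 2"
          using C by (intro mult_mono bound[where n = n] v_norm True) auto
        then show ?thesis using True by (simp add: norm_mult mult_ac)
      qed (use elim in \<open>auto simp: indicator_def\<close>)
    qed
    \<comment> \<open>Pointwise convergence uses continuity of \<open>g\<close> on the real line,
      which may fail at the two tips of the cuts; they form a null set.\<close>
    show "AE t in lborel. (\<lambda>n. indicator {0..} t *\<^sub>R (u (of_real t * v n) * v n))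
        \<longlonglongrightarrow> indicator {0..} t *\<^sub>R (u (of_real (e * t)) * of_real e)"
      using AE_lborel_singleton[of k] AE_lborel_singleton[of "- k"]
    proof eventually_elim
      case (elim t)
      have "\<bar>e * t\<bar> \<noteq> k" using elim e by (auto simp: abs_mult abs_if split: if_splits)
      then have "isCont u (of_real (e * t))"
        unfolding u_def by (intro continuous_intros cont)
      moreover have vlim: "v \<longlonglongrightarrow> of_real e"
      proof -
        have "(\<lambda>n. 1 / real (Suc n)) \<longlonglongrightarrow> 0" by real_asymp
        then have "(\<lambda>n. Complex e (1 / real (Suc n))) \<longlonglongrightarrow> Complex e 0"
          by (intro tendsto_intros)
        then show ?thesis by (simp add: v_def[abs_def] complex_of_real_def)
      qed
      moreover have "(\<lambda>n. of_real t * v n) \<longlonglongrightarrow> of_real (e * t)"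
        using tendsto_mult[OF tendsto_const vlim, of "of_real t"] by (simp add: mult.commute)
      ultimately show ?case
        by (intro tendsto_scaleR tendsto_mult tendsto_const isCont_tendsto_compose[of _ u])
    qed
  qed
  then have "(LINT t:{0..}|lborel. u (of_real t * \<i>) * \<i>) = (LINT t:{0..}|lborel. u (of_real (e * t)) * of_real e)"
    by (simp only: eq LIMSEQ_const_iff)
  moreover have "\<i> * \<tau> * (of_real t * \<i>) = - (\<tau> * of_real t)" for t
    by (simp add: algebra_simps)
  ultimately show ?thesis by (simp only: u_def)
qed

section \<open>Continuation in the frequency parameter\<close>

text \<open>The contour integral of \<open>g z * exp (\<i> * \<tau> * z)\<close> along the positive
  imaginary axis; the last factor \<open>\<i>\<close> is the derivative of
  \<open>z = t * \<i>\<close>.\<close>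

definition ray_Laplace :: "(complex \<Rightarrow> complex) \<Rightarrow> complex \<Rightarrow> complex" where
  "ray_Laplace g \<tau> = (LINT t:{0..}|lborel. g (of_real t * \<i>) * exp (- (\<tau> * of_real t)) * \<i>)"

lemma ray_Laplace_holomorphic:
  fixes g :: "complex \<Rightarrow> complex"
  assumes hol: "g holomorphic_on ({z. Im z > 0} \<union> ball 0 r)" and r: "r > 0"
    and growth: "\<And>z. Im z > 0 \<Longrightarrow> cmod (g z) \<le> C * exp (A * cmod z)" and C: "C > 0"
  shows "ray_Laplace g holomorphic_on {s. Re s > A}"
proof -
  define H where "H t = indicator {0..} t *\<^sub>R (g (of_real t * \<i>) * \<i>)" for t :: real
  have "continuous_on {0..} (\<lambda>t. g (of_real t * \<i>) * \<i>)"
  proof (intro continuous_intros continuous_on_compose2[OF holomorphic_on_imp_continuous_on[OF hol]])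
    show "(\<lambda>t. of_real t * \<i>) ` {0..} \<subseteq> {z. Im z > 0} \<union> ball 0 r"
    proof (intro image_subsetI)
      fix t :: real assume "t \<in> {0..}"
      then show "of_real t * \<i> \<in> {z. Im z > 0} \<union> ball 0 r"
        using r by (cases "t = 0") auto
    qed
  qed
  then have H[measurable]: "H \<in> borel_measurable borel"
    unfolding H_def[abs_def] by (intro borel_measurable_continuous_on_indicator) auto
  have "(\<lambda>s. LINT x|lborel. H x * exp (- (s * of_real x))) holomorphic_on {s. Re s > A}"
  proof (rule Laplace_transform_holomorphic)
    fix a assume a: "a > A"
    show "integrable lborel (\<lambda>x. exp (- (a * x)) *\<^sub>R H x)"
    proof (rule Bochner_Integration.integrable_bound)
      show "integrable lborel (\<lambda>t. C * (indicator {0..} t * exp (- ((a - A) * t))))"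
        using a by (intro integrable_mult_right integrable_exp_halfline) simp
      show "AE t in lborel. norm (exp (- (a * t)) *\<^sub>R H t) \<le> norm (C * (indicator {0..} t * exp (- ((a - A) * t))))"
        using AE_lborel_singleton[of "0::real"]
      proof eventually_elim
        case (elim t)
        show ?case
        proof (cases "t > 0")
          case True
          have "cmod (g (of_real t * \<i>)) \<le> C * exp (A * t)"
            using growth[of "of_real t * \<i>"] True by (simp add: norm_mult)
          then have "exp (- (a * t)) * cmod (g (of_real t * \<i>)) \<le> exp (- (a * t)) * (C * exp (A * t))"
            by (intro mult_left_mono) auto
          also have "\<dots> = C * exp (- ((a - A) * t))"
            by (simp add: algebra_simps flip: exp_add)
          finally show ?thesis using True C by (simp add: H_def norm_mult abs_mult)
        qed (use elim in \<open>auto simp: indicator_def H_def\<close>)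
      qed
    qed measurable
  qed (simp add: H_def)
  also have "(\<lambda>s. LINT x|lborel. H x * exp (- (s * of_real x))) = ray_Laplace g"
    by (intro ext) (simp only: ray_Laplace_def H_def set_lebesgue_integral_def scaleR_conv_of_real mult_ac)
  finally show ?thesis .
qed

text \<open>Rotation yields the identity only beyond \<open>2 * A\<close>. Both sides are
  holomorphic on the larger connected region \<open>?Q A 0\<close>, so the identity theorem extends
  it to the sharp bound \<open>A\<close>.\<close>

lemma half_line_transform_eq_ray_Laplace:
  fixes g :: "complex \<Rightarrow> complex" and e :: real
  assumes hol: "g holomorphic_on ({z. Im z > 0} \<union> ball 0 r)" and r: "r > 0"
    and growth: "\<And>z. Im z > 0 \<Longrightarrow> cmod (g z) \<le> C * exp (A * cmod z)" and C: "C > 0" and A: "A > 0"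
    and cont: "\<And>x::real. \<bar>x\<bar> \<noteq> k \<Longrightarrow> isCont g (of_real x)"
    and int: "\<And>a::real. a > 0 \<Longrightarrow> integrable lborel (\<lambda>x. exp (- (a * \<bar>x\<bar>)) *\<^sub>R g (of_real x))"
    and e: "\<bar>e\<bar> = 1" and tau: "Re \<tau> > A" "e * Im \<tau> > 0"
  shows "(LINT t:{0..}|lborel. g (of_real (e * t)) * exp (\<i> * \<tau> * of_real (e * t)) * of_real e) = ray_Laplace g \<tau>"
proof -
  have ee: "e * e = 1" using e by (metis abs_mult_self_eq mult_1)
  define H where "H t = indicator {0..} t *\<^sub>R (g (of_real (e * t)) * of_real e)" for t :: real
  let ?L = "\<lambda>s. LINT x|lborel. H x * exp (- (s * of_real x))"
  have Lhol: "?L holomorphic_on {s. Re s > 0}"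
  proof (rule Laplace_transform_holomorphic)
    fix a :: real assume a: "a > 0"
    let ?f = "\<lambda>x. exp (- (a * \<bar>x\<bar>)) *\<^sub>R g (of_real x)"
    have "integrable lborel (\<lambda>x. ?f (0 + e * x))"
      using e by (intro lborel_integrable_real_affine int a) auto
    then have "integrable lborel (\<lambda>x. indicator {0..} x *\<^sub>R (of_real e * ?f (0 + e * x)))"
      by (intro integrable_mult_indicator integrable_mult_right) auto
    also have "(\<lambda>x. indicator {0..} x *\<^sub>R (of_real e * ?f (0 + e * x))) = (\<lambda>x. exp (- (a * x)) *\<^sub>R H x)"
      using e by (auto simp: H_def indicator_def abs_mult mult_ac)
    finally show "integrable lborel (\<lambda>x. exp (- (a * x)) *\<^sub>R H x)" .
  qed (simp add: H_def)
  \<comment> \<open>The argument has real part \<open>e * Im \<tau>\<close>, so the condition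
    \<open>e * Im \<tau> > 0\<close> is exactly membership in the half-plane where \<open>?L\<close>
    is holomorphic.\<close>
  let ?I = "\<lambda>\<tau>. ?L (- (\<i> * \<tau> * of_real e))"
  have I: "?I \<tau> = (LINT t:{0..}|lborel. g (of_real (e * t)) * exp (\<i> * \<tau> * of_real (e * t)) * of_real e)" for \<tau>
    by (simp only: H_def set_lebesgue_integral_def scaleR_conv_of_real mult_minus_left minus_minus of_real_mult mult_ac)
       (simp only: mult_minus_left mult_minus_right minus_minus mult_ac)
  let ?Q = "\<lambda>a b. {z. Re z > a} \<inter> {z. Im (of_real e * z) > b}"
  have lin: "linear ((*) (of_real e :: complex))"
    by (intro bounded_linear.linear bounded_linear_mult_right)
  have oQ: "open (?Q a b)" for a b
    by (intro open_Int open_Collect_less continuous_intros)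
  have "?I \<tau> = ray_Laplace g \<tau>"
  proof (rule analytic_continuation_open[where s = "?Q (2 * A) (2 * A)" and s' = "?Q A 0"
        and f = ?I and g = "ray_Laplace g" and z = \<tau>])
    have "Complex (3 * A) (3 * A * e) \<in> ?Q (2 * A) (2 * A)"
      using A ee by (simp add: mult_ac)
    then show "?Q (2 * A) (2 * A) \<noteq> {}" by blast
    show "connected (?Q A 0)"
    proof (intro convex_connected convex_Int convex_halfspace_Re_gt)
      have "{z. Im (of_real e * z) > 0} = (*) (of_real e) -` {z. Im z > 0}" by auto
      then show "convex {z. Im (of_real e * z) > 0}"
        by (metis convex_linear_vimage lin convex_halfspace_Im_gt)
    qed
    show "?I holomorphic_on ?Q A 0"
      by (rule holomorphic_on_compose_gen[of "\<lambda>\<tau>. - (\<i> * \<tau> * of_real e)" _ ?L, OF _ Lhol, unfolded o_def])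
         (auto intro!: holomorphic_intros simp: mult_ac)
    show "ray_Laplace g holomorphic_on ?Q A 0"
      by (rule holomorphic_on_subset[OF ray_Laplace_holomorphic[OF hol r growth C]]) auto
    show "?I z = ray_Laplace g z" if "z \<in> ?Q (2 * A) (2 * A)" for z
      unfolding I ray_Laplace_def using that
      by (intro integral_ray_eq_real_limit[OF hol r growth C A cont e]) auto
  qed (use A oQ tau in auto)
  then show ?thesis by (simp only: I)
qed

text \<open>On each half-line the damping is absorbed into the phase as an imaginary part of \<tau>,
  \<open>d\<close> on the right and \<open>- d\<close> on the left. The minus sign comes from the
  factor \<open>e = -1\<close> on the left ray.\<close>

lemma fourier_L1_damped:
  fixes g :: "complex \<Rightarrow> complex"
  assumes hol: "g holomorphic_on ({z. Im z > 0} \<union> ball 0 r)" and r: "r > 0"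
    and growth: "\<And>z. Im z > 0 \<Longrightarrow> cmod (g z) \<le> C * exp (A * cmod z)" and C: "C > 0" and A: "A > 0"
    and cont: "\<And>x::real. \<bar>x\<bar> \<noteq> k \<Longrightarrow> isCont g (of_real x)"
    and int: "\<And>a::real. a > 0 \<Longrightarrow> integrable lborel (\<lambda>x. exp (- (a * \<bar>x\<bar>)) *\<^sub>R g (of_real x))"
    and t: "t < - A" and d: "d > 0"
  shows "fourier_L1 (\<lambda>x. exp (- (d * \<bar>x\<bar>)) *\<^sub>R g (of_real x)) t
       = ray_Laplace g (Complex (- t) d) - ray_Laplace g (Complex (- t) (- d))"
proof -
  let ?h = "\<lambda>x. exp (- (d * \<bar>x\<bar>)) *\<^sub>R g (of_real x) * exp (- (\<i> * of_real t * of_real x))"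
  have "integrable lborel ?h"
  proof (rule Bochner_Integration.integrable_bound[OF int[OF d]])
    have "(\<lambda>x. exp (- (d * \<bar>x\<bar>)) *\<^sub>R g (of_real x)) \<in> borel_measurable borel"
      using int[OF d] by auto
    then show "?h \<in> borel_measurable lborel" by measurable
  qed (simp add: norm_mult norm_exp_eq_Re)
  then have "fourier_L1 (\<lambda>x. exp (- (d * \<bar>x\<bar>)) *\<^sub>R g (of_real x)) t
      = (LINT x:{0..}|lborel. ?h x) + (LINT x:{0..}|lborel. ?h (- x))"
    unfolding fourier_L1_def by (rule integral_split_halflines)
  also have "(LINT x:{0..}|lborel. ?h x) = ray_Laplace g (Complex (- t) d)"
  proof -
    have "?h x = g (of_real (1 * x)) * exp (\<i> * Complex (- t) d * of_real (1 * x)) * of_real 1" if "x \<ge> 0" for x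
    proof -
      have "\<i> * Complex (- t) d * of_real x = of_real (- (d * x)) + (- (\<i> * of_real t * of_real x))"
        by (simp add: complex_eq_iff)
      then have "exp (\<i> * Complex (- t) d * of_real x) = of_real (exp (- (d * x))) * exp (- (\<i> * of_real t * of_real x))"
        by (simp only: exp_add exp_of_real)
      then show ?thesis
        using that by (simp add: scaleR_conv_of_real mult_ac)
    qed
    then have "(LINT x:{0..}|lborel. ?h x)
        = (LINT x:{0..}|lborel. g (of_real (1 * x)) * exp (\<i> * Complex (- t) d * of_real (1 * x)) * of_real 1)"
      by (intro set_lebesgue_integral_cong) auto
    also have "\<dots> = ray_Laplace g (Complex (- t) d)"
      using t d by (intro half_line_transform_eq_ray_Laplace[OF hol r growth C A cont int]) auto
    finally show ?thesis .
  qed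
  also have "(LINT x:{0..}|lborel. ?h (- x)) = - ray_Laplace g (Complex (- t) (- d))"
  proof -
    have "?h (- x) = - (g (of_real ((-1) * x)) * exp (\<i> * Complex (- t) (- d) * of_real ((-1) * x)) * of_real (-1))"
      if "x \<ge> 0" for x
    proof -
      have "\<i> * Complex (- t) (- d) * of_real ((-1) * x) = of_real (- (d * x)) + (- (\<i> * of_real t * of_real (- x)))"
        by (simp add: complex_eq_iff)
      then have "exp (\<i> * Complex (- t) (- d) * of_real ((-1) * x)) = of_real (exp (- (d * x))) * exp (- (\<i> * of_real t * of_real (- x)))"
        by (simp only: exp_add exp_of_real)
      then show ?thesis
        using that by (simp add: scaleR_conv_of_real mult_ac)
    qed
    then have "(LINT x:{0..}|lborel. ?h (- x))
        = (LINT x:{0..}|lborel. - (g (of_real ((-1) * x)) * exp (\<i> * Complex (- t) (- d) * of_real ((-1) * x)) * of_real (-1)))"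
      by (intro set_lebesgue_integral_cong) auto
    also have "\<dots> = - (LINT x:{0..}|lborel. g (of_real ((-1) * x)) * exp (\<i> * Complex (- t) (- d) * of_real ((-1) * x)) * of_real (-1))"
      by (simp add: set_lebesgue_integral_def)
    also have "\<dots> = - ray_Laplace g (Complex (- t) (- d))"
      using t d by (intro arg_cong[where f = uminus] half_line_transform_eq_ray_Laplace[OF hol r growth C A cont int]) auto
    finally show ?thesis .
  qed
  finally show ?thesis by simp
qed

section \<open>The support of the transform\<close>

text \<open>Dominated convergence: the damping factor lies between 0 and 1, so the squared error is
  at most \<open>|f|^2\<close>.\<close>

lemma L2_tendsto_damped:
  fixes f :: "real \<Rightarrow> complex"
  assumes [measurable]: "f \<in> borel_measurable borel" and fin: "L2sq f < \<infinity>"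
  shows "L2_tendsto (\<lambda>n x. exp (- (1 / real (Suc n) * \<bar>x\<bar>)) *\<^sub>R f x) f"
proof -
  have diff: "exp (- (1 / real (Suc n) * \<bar>x\<bar>)) *\<^sub>R f x - f x = (exp (- (1 / real (Suc n) * \<bar>x\<bar>)) - 1) *\<^sub>R f x" for n x
    by (simp add: scaleR_left_diff_distrib)
  have "(\<lambda>n. \<integral>\<^sup>+x. ennreal ((cmod (exp (- (1 / real (Suc n) * \<bar>x\<bar>)) *\<^sub>R f x - f x))\<^sup>2) \<partial>lborel)
      \<longlonglongrightarrow> (\<integral>\<^sup>+x. 0 \<partial>(lborel :: real measure))"
  proof (rule nn_integral_dominated_convergence[where w = "\<lambda>x. ennreal ((cmod (f x))\<^sup>2)"])
    show "(\<integral>\<^sup>+x. ennreal ((cmod (f x))\<^sup>2) \<partial>lborel) < \<infinity>" using fin by (simp add: L2sq_def)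
    show "AE x in lborel. ennreal ((cmod (exp (- (1 / real (Suc n) * \<bar>x\<bar>)) *\<^sub>R f x - f x))\<^sup>2) \<le> ennreal ((cmod (f x))\<^sup>2)" for n
    proof (intro AE_I2 ennreal_leI power_mono)
      fix x
      have "exp (- (1 / real (Suc n) * \<bar>x\<bar>)) \<le> 1" by simp
      then have "\<bar>exp (- (1 / real (Suc n) * \<bar>x\<bar>)) - 1\<bar> \<le> 1"
        using exp_ge_zero[of "- (1 / real (Suc n) * \<bar>x\<bar>)"] by linarith
      then show "cmod (exp (- (1 / real (Suc n) * \<bar>x\<bar>)) *\<^sub>R f x - f x) \<le> cmod (f x)"
        unfolding diff norm_scaleR by (intro mult_left_le_one_le) auto
    qed simp
    show "AE x in lborel. (\<lambda>n. ennreal ((cmod (exp (- (1 / real (Suc n) * \<bar>x\<bar>)) *\<^sub>R f x - f x))\<^sup>2)) \<longlonglongrightarrow> 0"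
    proof (intro AE_I2)
      fix x :: real
      have "(\<lambda>n. exp (- (1 / real (Suc n) * \<bar>x\<bar>)) - 1) \<longlonglongrightarrow> 0" by real_asymp
      then have "(\<lambda>n. ennreal ((cmod ((exp (- (1 / real (Suc n) * \<bar>x\<bar>)) - 1) *\<^sub>R f x))\<^sup>2)) \<longlonglongrightarrow> ennreal ((cmod (0 *\<^sub>R f x))\<^sup>2)"
        by (intro tendsto_intros)
      then show "(\<lambda>n. ennreal ((cmod (exp (- (1 / real (Suc n) * \<bar>x\<bar>)) *\<^sub>R f x - f x))\<^sup>2)) \<longlonglongrightarrow> 0"
        unfolding diff by simp
    qed
  qed measurable
  then show ?thesis by (simp add: L2_tendsto_def)
qed

text \<open>A product of two square-integrable functions is integrable, by
  \<open>2 * p * q \<le> p^2 + q^2\<close>; the square of the damping factor is again an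
  exponential.\<close>

lemma integrable_damped:
  fixes f :: "real \<Rightarrow> complex"
  assumes [measurable]: "f \<in> borel_measurable borel"
    and f: "integrable lborel (\<lambda>x. (cmod (f x))\<^sup>2)" and a: "a > 0"
  shows "integrable lborel (\<lambda>x. exp (- (a * \<bar>x\<bar>)) *\<^sub>R f x)"
proof (rule Bochner_Integration.integrable_bound)
  show "integrable lborel (\<lambda>x. exp (- (2 * a * \<bar>x\<bar>)) + (cmod (f x))\<^sup>2)"
    using a by (intro Bochner_Integration.integrable_add f integrable_exp_abs) simp
  show "AE x in lborel. norm (exp (- (a * \<bar>x\<bar>)) *\<^sub>R f x) \<le> norm (exp (- (2 * a * \<bar>x\<bar>)) + (cmod (f x))\<^sup>2)"
  proof (intro AE_I2)
    fix x
    let ?p = "exp (- (a * \<bar>x\<bar>))"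
    have "0 \<le> ?p * cmod (f x)" by simp
    moreover have "2 * (?p * cmod (f x)) \<le> ?p\<^sup>2 + (cmod (f x))\<^sup>2"
      using sum_squares_bound[of ?p "cmod (f x)"] by (simp only: mult.assoc)
    ultimately have "?p * cmod (f x) \<le> ?p\<^sup>2 + (cmod (f x))\<^sup>2" by linarith
    also have "?p\<^sup>2 = exp (- (2 * a * \<bar>x\<bar>))" by (simp add: power2_eq_square flip: exp_add)
    finally show "norm (?p *\<^sub>R f x) \<le> norm (exp (- (2 * a * \<bar>x\<bar>)) + (cmod (f x))\<^sup>2)" by simp
  qed
qed measurable

theorem theorem6:
  fixes A C k :: real and g :: "complex \<Rightarrow> complex" and G :: "real \<Rightarrow> complex"
  assumes "A > 0" and "C > 0" and "k > 0"
    and "g analytic_on - (lower_cut (of_real k) \<union> lower_cut (- of_real k))"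
    and "\<And>z. Im z > 0 \<Longrightarrow> cmod (g z) \<le> C * exp (A * cmod z)"
    and "integrable lborel (\<lambda>x::real. (cmod (g (of_real x)))\<^sup>2)"
    and "G = fourier_L2 (\<lambda>x. g (of_real x))"
  shows "ess_support G \<subseteq> {-A..} \<and> L2_on {-A<..} G"
proof -
  note A = assms(1) and C = assms(2) and k = assms(3) and ana = assms(4)
    and growth = assms(5) and sq = assms(6)
  let ?g = "\<lambda>x::real. g (of_real x)"
  have cuts: "z \<in> - (lower_cut (of_real k) \<union> lower_cut (- of_real k))"
    if "Im z > 0 \<or> \<bar>Re z\<bar> \<noteq> k" for z
    using that k by (auto simp: lower_cut_def)
  \<comment> \<open>The cuts lie in the lines \<open>|Re z| = k\<close> below the real axis or on
    it, so the disc of radius \<open>k\<close> about 0 avoids them and can serve as the ball at the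
    corner of the contours.\<close>
  have hol: "g holomorphic_on ({z. Im z > 0} \<union> ball 0 k)"
  proof (rule holomorphic_on_subset[OF analytic_imp_holomorphic[OF ana]], rule subsetI)
    fix z assume "z \<in> {z. Im z > 0} \<union> ball 0 k"
    then show "z \<in> - (lower_cut (of_real k) \<union> lower_cut (- of_real k))"
      using abs_Re_le_cmod[of z] by (intro cuts) auto
  qed
  have cont: "isCont g (of_real x)" if "\<bar>x\<bar> \<noteq> k" for x :: real
  proof -
    have "g analytic_on {of_real x}"
      using cuts[of "of_real x"] that by (intro analytic_on_subset[OF ana]) auto
    then show ?thesis by (rule analytic_at_imp_isCont)
  qed
  have "continuous_on (- {k, - k}) ?g"
  proof (intro continuous_at_imp_continuous_on ballI)
    fix x assume "x \<in> - {k, - k}"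
    then have "isCont g (of_real x)" by (intro cont) auto
    moreover have "isCont complex_of_real x"
      by (intro linear_continuous_at bounded_linear_of_real)
    ultimately show "isCont ?g x" by (rule isCont_o2[rotated])
  qed
  then have g[measurable]: "?g \<in> borel_measurable borel"
    by (intro borel_measurable_continuous_countable_exceptions[of "{k, - k}"]) auto
  have gfin: "L2sq ?g < \<infinity>"
    using sq by (simp add: L2sq_def integrable_iff_bounded)
  have int: "integrable lborel (\<lambda>x. exp (- (a * \<bar>x\<bar>)) *\<^sub>R ?g x)" if "a > 0" for a
    using that by (intro integrable_damped sq) auto
  define f where "f n x = exp (- (1 / real (Suc n) * \<bar>x\<bar>)) *\<^sub>R ?g x" for n x
  have f_int: "integrable lborel (f n)" for n
    unfolding f_def[abs_def] by (intro int) simp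
  then have [measurable]: "f n \<in> borel_measurable borel" for n by auto
  have f_L2: "L2_on UNIV (f n)" for n
  proof -
    have "L2sq (f n) \<le> L2sq ?g"
      unfolding L2sq_def f_def
      by (intro nn_integral_mono ennreal_leI power_mono) (auto intro!: mult_left_le_one_le)
    then show ?thesis using gfin by (simp add: L2_on_UNIV_iff)
  qed
  have f_lim: "L2_tendsto f ?g"
    unfolding f_def[abs_def] by (rule L2_tendsto_damped[OF g gfin])
  have G: "has_fourier_L2 ?g G"
    unfolding assms(7) fourier_L2_def
    by (rule someI_ex[OF has_fourier_L2_exists[OF g f_int f_L2 f_lim]])
  then have GL: "L2_on UNIV G" by (simp add: has_fourier_L2_def)
  then have [measurable]: "G \<in> borel_measurable borel" by (simp add: L2_on_UNIV_iff)
  have "AE t in lborel. t \<in> {..<-A} \<longrightarrow> G t = 0"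
  proof (rule L2_tendsto_AE_zero)
    show "L2_tendsto (\<lambda>n. fourier_L1 (f n)) G"
      by (rule L2_tendsto_fourier_L1[OF G g f_int f_lim])
    fix t assume "t \<in> {..<-A}"
    then have t: "t < - A" by simp
    \<comment> \<open>Because \<open>- t > A\<close>, this point is interior to the domain of
      holomorphy. The values from above and below the real axis therefore have a common limit, and
      their difference tends to 0.\<close>
    have "isCont (ray_Laplace g) (Complex (- t) 0)"
      using t by (intro continuous_on_interior[OF holomorphic_on_imp_continuous_on[OF
            ray_Laplace_holomorphic[OF hol k growth C]]])
        (auto simp: interior_open open_halfspace_Re_gt)
    then have lim: "(\<lambda>n. ray_Laplace g (Complex (- t) (s / real (Suc n)))) \<longlonglongrightarrow> ray_Laplace g (Complex (- t) 0)" for s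
    proof (rule isCont_tendsto_compose)
      have "(\<lambda>n. s / real (Suc n)) \<longlonglongrightarrow> 0" by real_asymp
      then show "(\<lambda>n. Complex (- t) (s / real (Suc n))) \<longlonglongrightarrow> Complex (- t) 0"
        by (intro tendsto_intros)
    qed
    have "fourier_L1 (f n) t = ray_Laplace g (Complex (- t) (1 / real (Suc n)))
        - ray_Laplace g (Complex (- t) (- 1 / real (Suc n)))" for n
      unfolding f_def[abs_def]
      by (subst fourier_L1_damped[OF hol k growth C A cont int t]) auto
    then show "(\<lambda>n. fourier_L1 (f n) t) \<longlonglongrightarrow> 0"
      using tendsto_diff[OF lim[of 1] lim[of "- 1"]] by simp
  qed auto
  then have "{..<-A} \<in> {U. open U \<and> (AE t in lborel. t \<in> U \<longrightarrow> G t = 0)}" by simp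
  then have "{..<-A} \<subseteq> - ess_support G"
    unfolding ess_support_def double_complement by (rule Union_upper)
  then have "ess_support G \<subseteq> {-A..}" by (auto simp: subset_iff not_less[symmetric])
  moreover have "L2_on {-A<..} G"
    unfolding L2_on_def
  proof
    show "set_borel_measurable lborel {-A<..} G" by (simp add: set_borel_measurable_def)
    show "set_integrable lborel {-A<..} (\<lambda>x. (cmod (G x))\<^sup>2)"
      using GL unfolding L2_on_def by (auto intro: set_integrable_subset)
  qed
  ultimately show ?thesis ..
qed

end
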